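(* Let $I$ be a squarefree monomial ideal of projective dimension one in the polynomial ring $S=\mathbb{K}[x_1,\ldots,x_n]$ over a field $\mathbb{K}$. If $I$ has a $d$-linear resolution, then $I^s$ has linear quotients for all $s\ge 1$.
   Context: The projective dimension of $I$ is that of $I$ as an $S$-module, and $\beta_{i,j}(I)$ denotes the $i$-th graded Betti number of the $S$-module $I$ in degree $j$. For an integer $d\ge 1$, a monomial ideal $I$ has a $d$-linear resolution if $\beta_{i,j}(I)=0$ for all $i,j$ with $j-i\ne d$. A monomial ideal has linear quotients if its minimal monomial generators can be ordered as $v_1,\ldots,v_m$ so that $(v_1,\ldots,v_{i-1}):v_i$ is generated by variables for all $i=2,\ldots,m$. *)

theory Defs
  imports "HOL-Library.Poly_Mapping" "HOL-Library.Extended_Nat"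
begin

(* The polynomial ring S = K[x_i : i in 'n], as finitely supported functions from exponent
   vectors to coefficients; Poly_Mapping supplies the ring structure.  The number of variables
   is CARD('n). *)
type_synonym 'n exponent = "'n \<Rightarrow>\<^sub>0 nat"
type_synonym ('n, 'k) mpoly = "'n exponent \<Rightarrow>\<^sub>0 'k"

definition monom :: "'n exponent \<Rightarrow> ('n, 'k::field) mpoly" where
  "monom m = Poly_Mapping.single m 1"

definition variable :: "'n \<Rightarrow> ('n, 'k::field) mpoly" where
  "variable i = monom (Poly_Mapping.single i 1)"

definition exponent_degree :: "'n::finite exponent \<Rightarrow> nat" where
  "exponent_degree m = (\<Sum>i\<in>UNIV. Poly_Mapping.lookup m i)"

definition squarefree_exponent :: "'n exponent \<Rightarrow> bool" where
  "squarefree_exponent m \<longleftrightarrow> (\<forall>i. Poly_Mapping.lookup m i \<le> 1)"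


section \<open>Ideals\<close>

lemma module_mult: "module ((*) :: 'a::comm_ring_1 \<Rightarrow> 'a \<Rightarrow> 'a)"
  by unfold_locales (simp_all add: algebra_simps)

abbreviation ideal_generated :: "'a::comm_ring_1 set \<Rightarrow> 'a set" where
  "ideal_generated \<equiv> module.span (*)"

definition ideal_power :: "'a::comm_ring_1 set \<Rightarrow> nat \<Rightarrow> 'a set" where
  "ideal_power I s = ideal_generated {\<Prod>i<s. f i |f. \<forall>i<s. f i \<in> I}"

definition ideal_colon :: "'a::comm_ring_1 set \<Rightarrow> 'a \<Rightarrow> 'a set" where
  "ideal_colon J v = {f. f * v \<in> J}"

definition squarefree_monomial_ideal :: "('n, 'k::field) mpoly set \<Rightarrow> bool" where
  "squarefree_monomial_ideal I \<longleftrightarrow>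
     (\<exists>G. (\<forall>m\<in>G. squarefree_exponent m) \<and> I = ideal_generated (monom ` G))"

definition minimal_monomial_generators :: "('n, 'k::field) mpoly set \<Rightarrow> 'n exponent set \<Rightarrow> bool" where
  "minimal_monomial_generators I G \<longleftrightarrow>
     ideal_generated (monom ` G) = I \<and> (\<forall>G'. G' \<subset> G \<longrightarrow> ideal_generated (monom ` G') \<noteq> I)"

definition has_linear_quotients :: "('n, 'k::field) mpoly set \<Rightarrow> bool" where
  "has_linear_quotients I \<longleftrightarrow>
     (\<exists>vs. distinct vs \<and> minimal_monomial_generators I (set vs) \<and>
        (\<forall>i. 0 < i \<and> i < length vs \<longrightarrow>
           (\<exists>X. ideal_colon (ideal_generated (monom ` set (take i vs))) (monom (vs ! i)) =
                (ideal_generated (variable ` X) :: ('n, 'k) mpoly set))))"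


section \<open>Resolutions\<close>

(* nat \<Rightarrow>\<^sub>0 S is the free S-module of countable rank.  It serves as the ambient module of all
   terms of a resolution. *)
definition vscale :: "'a::comm_ring_1 \<Rightarrow> (nat \<Rightarrow>\<^sub>0 'a) \<Rightarrow> (nat \<Rightarrow>\<^sub>0 'a)" where
  "vscale c v = Poly_Mapping.map ((*) c) v"

lemma lookup_vscale [simp]:
  "Poly_Mapping.lookup (vscale c v) k = c * Poly_Mapping.lookup v k"
  unfolding vscale_def by transfer (simp add: when_def)

lemma module_vscale: "module vscale"
  by unfold_locales
     (auto intro!: poly_mapping_eqI simp: lookup_add algebra_simps)

(* The sequence  ... \<rightarrow> M 2 \<rightarrow> M 1 \<rightarrow> M 0 \<rightarrow> I \<rightarrow> 0  with maps  \<phi> i : M (i+1) \<rightarrow> M i  and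
   \<epsilon> : M 0 \<rightarrow> I  is exact.  The maps are linear on the whole ambient module; this is no
   restriction when the M i are direct summands of it, since a linear map on a direct summand
   extends by zero on a complement.  That \<phi> i maps M (i+1) into M i is part of exactness. *)
definition exact_resolution ::
  "'a::comm_ring_1 set \<Rightarrow> (nat \<Rightarrow> (nat \<Rightarrow>\<^sub>0 'a) set) \<Rightarrow> ((nat \<Rightarrow>\<^sub>0 'a) \<Rightarrow> 'a) \<Rightarrow>
   (nat \<Rightarrow> (nat \<Rightarrow>\<^sub>0 'a) \<Rightarrow> (nat \<Rightarrow>\<^sub>0 'a)) \<Rightarrow> bool" where
  "exact_resolution I M \<epsilon> \<phi> \<longleftrightarrow>
     module_hom vscale (*) \<epsilon> \<and>
     (\<forall>i. module_hom vscale vscale (\<phi> i)) \<and>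
     \<epsilon> ` M 0 = I \<and>
     {v \<in> M 0. \<epsilon> v = 0} = \<phi> 0 ` M 1 \<and>
     (\<forall>i. {v \<in> M (Suc i). \<phi> i v = 0} = \<phi> (Suc i) ` M (Suc (Suc i)))"


subsection \<open>Projective dimension\<close>

(* Projective = direct summand of a free module.  Every countably generated projective module
   is, up to isomorphism, a direct summand of the free module of countable rank. *)
definition projective_submodule :: "(nat \<Rightarrow>\<^sub>0 'a::comm_ring_1) set \<Rightarrow> bool" where
  "projective_submodule P \<longleftrightarrow>
     module.subspace vscale P \<and>
     (\<exists>Q. module.subspace vscale Q \<and> P \<inter> Q = {0} \<and> {p + q |p q. p \<in> P \<and> q \<in> Q} = UNIV)"

definition has_projective_resolution :: "'a::comm_ring_1 set \<Rightarrow> nat \<Rightarrow> bool" where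
  "has_projective_resolution I n \<longleftrightarrow>
     (\<exists>P \<epsilon> \<phi>. (\<forall>i. projective_submodule (P i)) \<and> (\<forall>i>n. P i = {0}) \<and>
        exact_resolution I P \<epsilon> \<phi>)"

(* Least length of a projective resolution, and \<infinity> if there is none of finite length.  Over a
   Noetherian ring, countably generated projectives suffice for this: a finitely generated
   module having any projective resolution of length n has one by finitely generated projectives.
   The zero ideal gets value 0 here. *)
definition projective_dimension :: "'a::comm_ring_1 set \<Rightarrow> enat" where
  "projective_dimension I = Inf {enat n |n. has_projective_resolution I n}"


subsection \<open>Graded Betti numbers\<close>

definition homogeneous :: "nat \<Rightarrow> ('n::finite, 'k::field) mpoly \<Rightarrow> bool" where
  "homogeneous j f \<longleftrightarrow> (\<forall>m \<in> Poly_Mapping.keys f. exponent_degree m = j)"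

definition free_submodule :: "nat \<Rightarrow> (nat \<Rightarrow>\<^sub>0 'a::comm_ring_1) set" where
  "free_submodule r = {v. Poly_Mapping.keys v \<subseteq> {..<r}}"

definition unit_vector :: "nat \<Rightarrow> (nat \<Rightarrow>\<^sub>0 'a::comm_ring_1)" where
  "unit_vector k = Poly_Mapping.single k 1"

(* A list a of degrees stands for the graded free module  S(-a!0) \<oplus> ... \<oplus> S(-a!(r-1)),
   r = length a,  whose k-th basis vector has degree a!k; its underlying module is
   free_submodule r.  Natural numbers suffice as degrees, because the minimal resolution of an
   ideal has no generators in negative degrees. *)
definition homogeneous_vector :: "nat list \<Rightarrow> nat \<Rightarrow> (nat \<Rightarrow>\<^sub>0 ('n::finite, 'k::field) mpoly) \<Rightarrow> bool" where
  "homogeneous_vector a j v \<longleftrightarrow>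
     (\<forall>k<length a. \<forall>m \<in> Poly_Mapping.keys (Poly_Mapping.lookup v k). exponent_degree m + a ! k = j)"

(* The maps have degree 0, which is required on basis vectors.  The last condition is minimality:
   the image of \<phi> i lies in  (x_1,...,x_n) F_i,  i.e. all its components have constant term 0. *)
definition minimal_graded_free_resolution ::
  "('n::finite, 'k::field) mpoly set \<Rightarrow> (nat \<Rightarrow> nat list) \<Rightarrow>
   ((nat \<Rightarrow>\<^sub>0 ('n, 'k) mpoly) \<Rightarrow> ('n, 'k) mpoly) \<Rightarrow>
   (nat \<Rightarrow> (nat \<Rightarrow>\<^sub>0 ('n, 'k) mpoly) \<Rightarrow> (nat \<Rightarrow>\<^sub>0 ('n, 'k) mpoly)) \<Rightarrow> bool" where
  "minimal_graded_free_resolution I a \<epsilon> \<phi> \<longleftrightarrow>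
     exact_resolution I (\<lambda>i. free_submodule (length (a i))) \<epsilon> \<phi> \<and>
     (\<forall>k<length (a 0). homogeneous (a 0 ! k) (\<epsilon> (unit_vector k))) \<and>
     (\<forall>i. \<forall>k<length (a (Suc i)).
        homogeneous_vector (a i) (a (Suc i) ! k) (\<phi> i (unit_vector k))) \<and>
     (\<forall>i. \<forall>v\<in>free_submodule (length (a (Suc i))).
        \<forall>l. Poly_Mapping.lookup (Poly_Mapping.lookup (\<phi> i v) l) 0 = 0)"

(* The degree lists of one minimal graded free resolution.  Every homogeneous ideal has one, and
   it is unique up to graded isomorphism, so a i is determined up to order. *)
definition resolution_degrees :: "('n::finite, 'k::field) mpoly set \<Rightarrow> nat \<Rightarrow> nat list" where
  "resolution_degrees I = (SOME a. \<exists>\<epsilon> \<phi>. minimal_graded_free_resolution I a \<epsilon> \<phi>)"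

definition graded_betti :: "('n::finite, 'k::field) mpoly set \<Rightarrow> nat \<Rightarrow> nat \<Rightarrow> nat" where
  "graded_betti I i j = count_list (resolution_degrees I i) j"

(* j \<noteq> i + d is j - i \<noteq> d without truncated subtraction. *)
definition has_linear_resolution :: "nat \<Rightarrow> ('n::finite, 'k::field) mpoly set \<Rightarrow> bool" where
  "has_linear_resolution d I \<longleftrightarrow> (\<forall>i j. j \<noteq> i + d \<longrightarrow> graded_betti I i j = 0)"

end

theory Submission
  imports Defs "HOL-Library.Multiset_Order"
begin

text \<open>
  Let \<open>u_0, \<dots>, u_(m-1)\<close> be the minimal monomial generators of \<open>I\<close>. The syzygies of the \<open>u_k\<close> are
  generated by those of pairs. Since \<open>I\<close> has projective dimension one, its module of syzygies is
  projective, and a minimal generating subset of the pair syzygies has to be a basis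
  (\<open>minimal_presentation_injective\<close>, \<open>pair_syzygy_basis\<close>). This produces a minimal graded free
  resolution of \<open>I\<close>. Its existence matters because the graded Betti numbers are read off a resolution
  picked by Hilbert choice, so that the linearity hypothesis says something only once there is one to
  be picked.

  If the resolution is linear, then all \<open>u_k\<close> have degree \<open>d\<close>, and the syzygies are already generated
  by those of pairs whose least common multiple has degree \<open>d + 1\<close> (\<open>linear_resolution_syzygies\<close>).
  The basis can be chosen among these pairs; it is regarded as the edge set of a graph on the
  generators. Setting all variables to \<open>1\<close> turns the basis into linearly independent edge vectors, so
  there are fewer edges than vertices, and some vertex \<open>k\<close> is a leaf. Let its edge carry the relation
  between \<open>x_v u_k\<close> and \<open>x_q u_l\<close>. Every syzygy involves \<open>u_k\<close> through this relation only; hence \<open>x_v\<close>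
  divides \<open>lcm u_k u_j / u_k\<close> for each \<open>j \<noteq> k\<close>, and as the generators are squarefree, \<open>x_v\<close> divides all
  the \<open>u_j\<close> exactly once and does not divide \<open>u_k\<close>. Removing leaves one after the other orders the
  generators in such a way that each \<open>u_i\<close> except the first has a variable \<open>v_i\<close> that divides every
  earlier generator exactly once, does not divide \<open>u_i\<close>, and turns \<open>u_i\<close> into a multiple of an earlier
  generator (\<open>tree_elimination_order\<close>).

  The generators of \<open>I ^ s\<close> are the products over multisets of size \<open>s\<close> of indices; they are ordered by
  the multiset order. If \<open>X < Y\<close> and \<open>i\<close> is the largest index that remains after the common part is
  cancelled, then \<open>i\<close> comes from \<open>Y\<close>, and \<open>v_i\<close> has a larger exponent in the product over \<open>X\<close> than in
  the product over \<open>Y\<close> (\<open>product_separation\<close>). So the products are distinct, and every monomial that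
  multiplies the product over \<open>Y\<close> into the ideal of the earlier products is divisible by some \<open>v_i\<close> with
  \<open>i\<close> in \<open>Y\<close>. Conversely, each such \<open>v_i\<close> works, because one factor \<open>u_i\<close> can be exchanged for an earlier
  generator. The colon ideals are therefore generated by variables (\<open>powers_linear_quotients\<close>).
\<close>

abbreviation lookup :: "('a \<Rightarrow>\<^sub>0 'b::zero) \<Rightarrow> 'a \<Rightarrow> 'b" where
  "lookup \<equiv> Poly_Mapping.lookup"

abbreviation keys :: "('a \<Rightarrow>\<^sub>0 'b::zero) \<Rightarrow> 'a set" where
  "keys \<equiv> Poly_Mapping.keys"

abbreviation single :: "'a \<Rightarrow> 'b \<Rightarrow> ('a \<Rightarrow>\<^sub>0 'b::zero)" where
  "single \<equiv> Poly_Mapping.single"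

interpretation free_module: module "vscale :: 'a::comm_ring_1 \<Rightarrow> _"
  by (rule module_vscale)

interpretation ring_module: module "(*) :: 'a::comm_ring_1 \<Rightarrow> 'a \<Rightarrow> 'a"
  by (rule module_mult)

section \<open>Linear maps out of free modules\<close>

definition extend_linearly ::
  "('a::comm_ring_1 \<Rightarrow> 'b::ab_group_add \<Rightarrow> 'b) \<Rightarrow> (nat \<Rightarrow> 'b) \<Rightarrow> (nat \<Rightarrow>\<^sub>0 'a) \<Rightarrow> 'b" where
  "extend_linearly scale w v = (\<Sum>k\<in>keys v. scale (lookup v k) (w k))"

context module
begin

lemma extend_linearly_superset:
  assumes "finite A" "keys v \<subseteq> A"
  shows "extend_linearly scale w v = (\<Sum>k\<in>A. scale (lookup v k) (w k))"
  unfolding extend_linearly_def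
  by (rule sum.mono_neutral_left) (use assms in \<open>auto simp: in_keys_iff\<close>)

lemma extend_linearly_hom: "module_hom vscale scale (extend_linearly scale w)"
proof (unfold_locales, goal_cases)
  case (1 x y)
  have "extend_linearly scale w z = (\<Sum>k\<in>keys x \<union> keys y. scale (lookup z k) (w k))"
    if "keys z \<subseteq> keys x \<union> keys y" for z
    by (rule extend_linearly_superset) (use that in auto)
  moreover have "keys (x + y) \<subseteq> keys x \<union> keys y"
    by (rule Poly_Mapping.keys_add)
  ultimately show ?case
    by (simp add: lookup_add scale_left_distrib sum.distrib)
next
  case (2 r x)
  have "keys (vscale r x) \<subseteq> keys x"
    by (auto simp: in_keys_iff)
  then show ?case
    by (simp add: extend_linearly_superset[of "keys x"] scale_sum_right)
qed

lemma extend_linearly_unit_vector [simp]: "extend_linearly scale w (unit_vector k) = w k"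
  by (simp add: extend_linearly_def unit_vector_def)

lemma extend_linearly_free:
  assumes "v \<in> free_submodule r"
  shows "extend_linearly scale w v = (\<Sum>k<r. scale (lookup v k) (w k))"
  by (rule extend_linearly_superset) (use assms in \<open>auto simp: free_submodule_def\<close>)

end

lemma lookup_unit_vector: "lookup (unit_vector k) l = (if k = l then 1 else 0)"
  by (simp add: unit_vector_def lookup_single when_def)

lemma vector_eq_sum_unit_vectors:
  assumes "finite A" "keys v \<subseteq> A"
  shows "v = (\<Sum>k\<in>A. vscale (lookup v k) (unit_vector k))"
proof (rule poly_mapping_eqI)
  fix l
  have "lookup (\<Sum>k\<in>A. vscale (lookup v k) (unit_vector k)) l
      = (\<Sum>k\<in>A. if k = l then lookup v k else 0)"
    unfolding lookup_sum
    by (intro sum.cong) (auto simp: unit_vector_def lookup_single when_def)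
  then show "lookup v l = lookup (\<Sum>k\<in>A. vscale (lookup v k) (unit_vector k)) l"
    using assms by (auto simp: in_keys_iff)
qed

lemma hom_eq_sum:
  assumes "module_hom vscale scale h" "finite A" "keys v \<subseteq> A"
  shows "h v = (\<Sum>k\<in>A. scale (lookup v k) (h (unit_vector k)))"
proof -
  interpret h: module_hom vscale scale h by fact
  have "h v = h (\<Sum>k\<in>A. vscale (lookup v k) (unit_vector k))"
    using vector_eq_sum_unit_vectors[OF assms(2,3)] by simp
  then show ?thesis
    by (simp add: h.sum h.scale)
qed

lemma hom_eq_sum_free:
  assumes "module_hom vscale scale h" "v \<in> free_submodule r"
  shows "h v = (\<Sum>k<r. scale (lookup v k) (h (unit_vector k)))"
  by (rule hom_eq_sum) (use assms in \<open>auto simp: free_submodule_def\<close>)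

lemma hom_eqI:
  assumes "module_hom vscale scale g" "module_hom vscale scale h"
    and "\<And>k. g (unit_vector k) = h (unit_vector k)"
  shows "g v = h v"
  using assms hom_eq_sum[of scale g "keys v" v] hom_eq_sum[of scale h "keys v" v] by simp

lemma subspace_free_submodule: "free_module.subspace (free_submodule r)"
proof -
  have "free_submodule r = {v. \<forall>k\<ge>r. lookup v k = 0}"
    by (auto simp: free_submodule_def in_keys_iff subset_iff) (meson leI)
  then show ?thesis
    by (auto simp: free_module.subspace_def lookup_add)
qed

lemma unit_vector_free_submodule [simp]:
  "(unit_vector k :: nat \<Rightarrow>\<^sub>0 'a::comm_ring_1) \<in> free_submodule r \<longleftrightarrow> k < r"
  by (simp add: free_submodule_def unit_vector_def)

lemma single_free_submodule: "k < m \<Longrightarrow> single k p \<in> free_submodule m"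
  by (simp add: free_submodule_def)

lemma free_submodule_projective:
  "projective_submodule (free_submodule r :: (nat \<Rightarrow>\<^sub>0 'a::comm_ring_1) set)"
proof -
  let ?Q = "{v :: nat \<Rightarrow>\<^sub>0 'a. \<forall>k<r. lookup v k = 0}"
  have "free_module.subspace ?Q"
    by (auto simp: free_module.subspace_def lookup_add)
  moreover have "free_submodule r \<inter> ?Q = {0}"
  proof (rule equalityI; rule subsetI)
    fix v :: "nat \<Rightarrow>\<^sub>0 'a" assume v: "v \<in> free_submodule r \<inter> ?Q"
    then have "lookup v k = 0" for k
      by (cases "k < r") (auto simp: free_submodule_def in_keys_iff subset_iff)
    then show "v \<in> {0}" by (simp add: poly_mapping_eqI)
  qed (simp add: free_submodule_def)
  moreover have "\<exists>p q. v = p + q \<and> p \<in> free_submodule r \<and> q \<in> ?Q" for v :: "nat \<Rightarrow>\<^sub>0 'a"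
  proof -
    let ?p = "\<Sum>k<r. vscale (lookup v k) (unit_vector k)"
    have p: "?p \<in> free_submodule r"
      by (intro free_module.subspace_sum free_module.subspace_scale subspace_free_submodule) auto
    have "lookup ?p l = lookup v l" if "l < r" for l
    proof -
      have "lookup ?p l = (\<Sum>k<r. if k = l then lookup v k else 0)"
        unfolding lookup_sum
        by (intro sum.cong) (auto simp: unit_vector_def lookup_single when_def)
      then show ?thesis using that by simp
    qed
    then have "v - ?p \<in> ?Q"
      by (simp add: lookup_minus)
    then show ?thesis
      using p by (intro exI[of _ ?p] exI[of _ "v - ?p"]) simp
  qed
  ultimately show ?thesis
    unfolding projective_submodule_def using subspace_free_submodule by blast
qed

context module
begin

lemma image_extend_linearly: "extend_linearly scale w ` free_submodule r = span (w ` {..<r})"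
proof (rule antisym)
  show "extend_linearly scale w ` free_submodule r \<subseteq> span (w ` {..<r})"
    by (auto simp: extend_linearly_free intro!: span_sum intro: span_scale span_base)
  interpret h: module_hom vscale scale "extend_linearly scale w"
    by (rule extend_linearly_hom)
  have "w k \<in> extend_linearly scale w ` free_submodule r" if "k < r" for k
    by (rule image_eqI[of _ _ "unit_vector k"]) (use that in auto)
  then show "span (w ` {..<r}) \<subseteq> extend_linearly scale w ` free_submodule r"
    by (intro span_minimal h.subspace_image subspace_free_submodule) auto
qed

lemma extend_linearly_list:
  assumes "distinct es" "v \<in> free_submodule (length es)"
    and "\<And>j. j < length es \<Longrightarrow> h (es ! j) = lookup v j"
  shows "extend_linearly scale (\<lambda>j. w (es ! j)) v = (\<Sum>e\<in>set es. scale (h e) (w e))"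
  unfolding extend_linearly_free[OF assms(2)]
    sum.reindex_bij_betw[OF bij_betw_nth[OF assms(1) refl refl], symmetric]
  by (intro sum.cong) (auto simp: assms(3))

lemma list_coefficients:
  assumes "distinct es"
  shows "\<exists>h. \<forall>j<length es. h (es ! j) = f j"
  using bij_betw_nth[OF assms refl refl]
  by (intro exI[of _ "\<lambda>e. f (the_inv_into {..<length es} ((!) es) e)"])
     (simp add: bij_betw_def the_inv_into_f_f)

lemma image_extend_linearly_list:
  "extend_linearly scale (\<lambda>j. w (es ! j)) ` free_submodule (length es) = span (w ` set es)"
proof -
  have "set es = (!) es ` {..<length es}" by (auto simp: set_conv_nth)
  then show ?thesis by (simp add: image_extend_linearly image_image)
qed

lemma in_span_image_finite:
  assumes "finite E" "x \<in> span (w ` E)"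
  shows "\<exists>h. x = (\<Sum>e\<in>E. scale (h e) (w e))"
proof -
  obtain es where es: "set es = E" "distinct es" using finite_distinct_list[OF assms(1)] by blast
  then obtain v where v: "v \<in> free_submodule (length es)"
      "x = extend_linearly scale (\<lambda>j. w (es ! j)) v"
    using assms(2) image_extend_linearly_list[of w es] by blast
  obtain h where "\<forall>j<length es. h (es ! j) = lookup v j" using list_coefficients[OF es(2)] by blast
  then show ?thesis using extend_linearly_list[OF es(2) v(1), of h w] v(2) es(1) by auto
qed

text \<open>A finite set is linearly independent if and only if a map of free modules that sends the
  basis vectors to an enumeration of it is injective. The left-hand side is convenient for counting and
  for graphs, the right-hand side for resolutions.\<close>
lemma independent_list_iff:
  assumes "distinct es"
  shows "(\<forall>h. (\<Sum>e\<in>set es. scale (h e) (w e)) = 0 \<longrightarrow> (\<forall>e\<in>set es. h e = 0)) \<longleftrightarrow>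
    (\<forall>v\<in>free_submodule (length es). extend_linearly scale (\<lambda>j. w (es ! j)) v = 0 \<longrightarrow> v = 0)"
proof (intro iffI allI ballI impI)
  fix v :: "nat \<Rightarrow>\<^sub>0 'a"
  assume indep: "\<forall>h. (\<Sum>e\<in>set es. scale (h e) (w e)) = 0 \<longrightarrow> (\<forall>e\<in>set es. h e = 0)"
    and v: "v \<in> free_submodule (length es)" "extend_linearly scale (\<lambda>j. w (es ! j)) v = 0"
  obtain h where h: "\<And>j. j < length es \<Longrightarrow> h (es ! j) = lookup v j"
    using list_coefficients[OF assms] by blast
  then have "h e = 0" if "e \<in> set es" for e
    using indep v extend_linearly_list[OF assms v(1) h, of w] that by auto
  then have "lookup v j = 0" for j
    using h[of j] v(1) by (cases "j < length es") (auto simp: free_submodule_def in_keys_iff)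
  then show "v = 0" by (simp add: poly_mapping_eqI)
next
  fix h e
  assume ker: "\<forall>v\<in>free_submodule (length es).
      extend_linearly scale (\<lambda>j. w (es ! j)) v = 0 \<longrightarrow> v = 0"
    and rel: "(\<Sum>e\<in>set es. scale (h e) (w e)) = 0" and e: "e \<in> set es"
  define v where "v = (\<Sum>j<length es. single j (h (es ! j)))"
  have look: "lookup v j = (if j < length es then h (es ! j) else 0)" for j
    by (simp add: v_def lookup_sum lookup_single when_def)
  then have v: "v \<in> free_submodule (length es)"
    by (auto simp: free_submodule_def in_keys_iff split: if_splits)
  then have "v = 0" using ker rel extend_linearly_list[OF assms v, of h w] by (simp add: look)
  then show "h e = 0" using look e by (metis in_set_conv_nth lookup_zero)
qed

end

section \<open>Projective modules and lifting\<close>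

lemma projective_projection:
  assumes "projective_submodule P"
  obtains p where "module_hom vscale vscale p" "\<And>v. p v \<in> P" "\<And>v. v \<in> P \<Longrightarrow> p v = v"
proof -
  obtain Q where P: "free_module.subspace P" and Q: "free_module.subspace Q"
    and PQ: "P \<inter> Q = {0}" "{p + q |p q. p \<in> P \<and> q \<in> Q} = UNIV"
    using assms unfolding projective_submodule_def by auto
  have "\<exists>p. p \<in> P \<and> v - p \<in> Q" for v
  proof -
    have "v \<in> {p + q |p q. p \<in> P \<and> q \<in> Q}" using PQ(2) by simp
    then show ?thesis by (auto intro: exI)
  qed
  then obtain p where p: "p v \<in> P" "v - p v \<in> Q" for v by metis
  have uniq: "p v = x" if "x \<in> P" "v - x \<in> Q" for v x
  proof -
    have "p v - x \<in> P"
      using P p(1) that(1) by (rule free_module.subspace_diff)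
    moreover have "(v - x) - (v - p v) \<in> Q"
      using Q that(2) p(2) by (rule free_module.subspace_diff)
    ultimately have "p v - x \<in> P \<inter> Q" by simp
    then show ?thesis using PQ(1) by simp
  qed
  have "module_hom vscale vscale p"
  proof (unfold_locales, goal_cases)
    case (1 x y)
    show ?case
    proof (rule uniq)
      show "p x + p y \<in> P" by (intro free_module.subspace_add P p)
      have "(x - p x) + (y - p y) \<in> Q" by (intro free_module.subspace_add Q p)
      then show "x + y - (p x + p y) \<in> Q" by (simp add: algebra_simps)
    qed
  next
    case (2 r x)
    show ?case
    proof (rule uniq)
      show "vscale r (p x) \<in> P" by (intro free_module.subspace_scale P p)
      have "vscale r (x - p x) \<in> Q" by (intro free_module.subspace_scale Q p)
      then show "vscale r x - vscale r (p x) \<in> Q"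
        by (simp add: free_module.scale_right_diff_distrib)
    qed
  qed
  moreover have "p v = v" if "v \<in> P" for v
    by (rule uniq) (use that free_module.subspace_0[OF Q] in auto)
  ultimately show thesis using that p(1) by blast
qed

text \<open>A projective module that sits in a free module as a direct summand lifts along
  surjections: project a basis of the free module to the summand and lift the images one by one. The lift
  is defined on the whole free module.\<close>
lemma projective_lift:
  assumes P: "projective_submodule P"
    and \<alpha>: "module_hom vscale scale \<alpha>" and \<beta>: "module_hom vscale scale \<beta>"
    and F: "free_module.subspace F" and im: "\<alpha> ` P \<subseteq> \<beta> ` F"
  obtains \<gamma> where "module_hom vscale vscale \<gamma>" "\<And>v. \<gamma> v \<in> F" "\<And>v. v \<in> P \<Longrightarrow> \<beta> (\<gamma> v) = \<alpha> v"
proof -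
  obtain p where p: "module_hom vscale vscale p" "\<And>v. p v \<in> P" "\<And>v. v \<in> P \<Longrightarrow> p v = v"
    using projective_projection[OF P] by blast
  have "\<exists>x\<in>F. \<beta> x = \<alpha> (p (unit_vector k))" for k
    using im p(2)[of "unit_vector k"] by force
  then obtain w where w: "w k \<in> F" "\<beta> (w k) = \<alpha> (p (unit_vector k))" for k by metis
  let ?\<gamma> = "extend_linearly vscale w"
  have hom: "module_hom vscale vscale ?\<gamma>" by (rule free_module.extend_linearly_hom)
  have "\<beta> (?\<gamma> v) = \<alpha> (p v)" for v
  proof -
    have "(\<beta> \<circ> ?\<gamma>) v = (\<alpha> \<circ> p) v"
      by (rule hom_eqI[OF module_hom_compose[OF hom \<beta>] module_hom_compose[OF p(1) \<alpha>]])
         (simp add: w)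
    then show ?thesis by simp
  qed
  moreover have "?\<gamma> v \<in> F" for v
    unfolding extend_linearly_def
    by (intro free_module.subspace_sum free_module.subspace_scale F w)
  ultimately show thesis using that hom p(3) by auto
qed

section \<open>Minimal presentations in projective dimension one\<close>

text \<open>Membership in the \<open>N\<close>-th power of the ideal generated by the variables.\<close>
definition order_at_least :: "nat \<Rightarrow> ('n::finite, 'k::field) mpoly \<Rightarrow> bool" where
  "order_at_least N p \<longleftrightarrow> (\<forall>w. exponent_degree w < N \<longrightarrow> lookup p w = 0)"

lemma exponent_degree_add: "exponent_degree (a + b) = exponent_degree a + exponent_degree b"
  by (simp add: exponent_degree_def lookup_add sum.distrib)

lemma exponent_degree_0 [simp]: "exponent_degree 0 = 0"
  by (simp add: exponent_degree_def)

lemma exponent_degree_eq_0_iff [simp]: "exponent_degree a = 0 \<longleftrightarrow> a = 0"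
  by (auto simp: exponent_degree_def intro!: poly_mapping_eqI)

lemma keys_multE:
  assumes "M \<in> keys (p * q)"
  obtains a b where "a \<in> keys p" "b \<in> keys q" "M = a + b"
  using assms Poly_Mapping.keys_mult[of p q] by auto

lemma keys_sumE:
  assumes "M \<in> keys (\<Sum>x\<in>A. f x)"
  obtains x where "x \<in> A" "M \<in> keys (f x)"
proof -
  have "\<exists>x\<in>A. lookup (f x) M \<noteq> 0"
    using assms by (auto simp: in_keys_iff lookup_sum intro: ccontr sum.neutral)
  then show thesis using that by (auto simp: in_keys_iff)
qed

lemma order_at_least_mult:
  assumes "order_at_least N p" "lookup q 0 = 0"
  shows "order_at_least (Suc N) (p * q)"
  unfolding order_at_least_def
proof (intro allI impI, rule ccontr)
  fix w assume "exponent_degree w < Suc N" "lookup (p * q) w \<noteq> 0"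
  then obtain a b where ab: "lookup p a \<noteq> 0" "lookup q b \<noteq> 0" "w = a + b"
    using keys_multE[of w p q] by (metis in_keys_iff)
  have "exponent_degree a \<ge> N"
    using assms(1) ab(1) by (auto simp: order_at_least_def not_less intro: leI)
  moreover have "exponent_degree b \<noteq> 0"
    using assms(2) ab(2) by auto
  ultimately show False
    using \<open>exponent_degree w < Suc N\<close> unfolding ab(3) exponent_degree_add by simp
qed

lemma order_at_least_sum:
  assumes "\<And>x. x \<in> A \<Longrightarrow> order_at_least N (f x)"
  shows "order_at_least N (\<Sum>x\<in>A. f x)"
  using assms by (simp add: order_at_least_def lookup_sum)

text \<open>A submodule \<open>K\<close> contained in \<open>\<mm> F\<close>, where \<open>\<mm>\<close> is the ideal generated by the variables
  and \<open>F\<close> is free, is zero if it is a retract of \<open>F\<close>. Indeed, the retraction maps \<open>\<mm>^N F\<close> into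
  \<open>\<mm>^(N+1) F\<close>; as it fixes \<open>K\<close>, all of \<open>K\<close> lies in \<open>\<mm>^N F\<close> for every \<open>N\<close>. This takes the place of
  Nakayama's lemma.\<close>
lemma minimal_idempotent_trivial:
  fixes K :: "(nat \<Rightarrow>\<^sub>0 ('n::finite, 'k::field) mpoly) set"
  assumes hom: "module_hom vscale vscale \<kappa>"
    and K: "K \<subseteq> free_submodule r"
    and \<kappa>: "\<And>k. k < r \<Longrightarrow> \<kappa> (unit_vector k) \<in> K" and idem: "\<And>v. v \<in> K \<Longrightarrow> \<kappa> v = v"
    and min: "\<And>v l. v \<in> K \<Longrightarrow> lookup (lookup v l) 0 = 0"
    and v: "v \<in> K"
  shows "v = 0"
proof -
  have "order_at_least N (lookup v l)" for N l
  proof (induction N arbitrary: l)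
    case 0
    show ?case by (simp add: order_at_least_def)
  next
    case (Suc N)
    have "v = (\<Sum>k<r. vscale (lookup v k) (\<kappa> (unit_vector k)))"
      using hom_eq_sum_free[OF hom, of v r] v K idem by auto
    then have "lookup v l = (\<Sum>k<r. lookup v k * lookup (\<kappa> (unit_vector k)) l)"
      by (metis (no_types, lifting) lookup_sum lookup_vscale sum.cong)
    moreover have "order_at_least (Suc N) (\<Sum>k<r. lookup v k * lookup (\<kappa> (unit_vector k)) l)"
      by (intro order_at_least_sum order_at_least_mult Suc min \<kappa>) auto
    ultimately show ?case by simp
  qed
  then have "lookup (lookup v l) w = 0" for l w
    unfolding order_at_least_def by blast
  then show ?thesis by (auto intro!: poly_mapping_eqI)
qed

text \<open>The kernel of a minimal presentation splits off: comparing the presentation with a projective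
  resolution of length one gives an endomorphism of the free module of relations that maps into the kernel
  of \<open>\<pi>\<close> and is the identity there. By minimality this forces the kernel to vanish.\<close>
lemma minimal_presentation_injective:
  fixes I :: "('n::finite, 'k::field) mpoly set"
  assumes pd: "has_projective_resolution I 1"
    and \<epsilon>: "module_hom vscale (*) \<epsilon>" and \<pi>: "module_hom vscale vscale \<pi>"
    and surj: "\<epsilon> ` free_submodule m = I"
    and exact: "{v \<in> free_submodule m. \<epsilon> v = 0} = \<pi> ` free_submodule r"
    and min: "\<And>v l. v \<in> free_submodule r \<Longrightarrow> \<pi> v = 0 \<Longrightarrow> lookup (lookup v l) 0 = 0"
    and v: "v \<in> free_submodule r" "\<pi> v = 0"
  shows "v = 0"
proof -
  obtain P \<delta> \<phi> where P: "\<And>i. projective_submodule (P i)" "\<And>i. i > 1 \<Longrightarrow> P i = {0}"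
    and res: "exact_resolution I P \<delta> \<phi>"
    using pd unfolding has_projective_resolution_def by blast
  let ?\<phi> = "\<phi> 0"
  have \<delta>: "module_hom vscale (*) \<delta>" and \<phi>: "module_hom vscale vscale ?\<phi>"
    and im: "\<delta> ` P 0 = I" and ker0: "{v \<in> P 0. \<delta> v = 0} = ?\<phi> ` P (Suc 0)"
    and "{v \<in> P (Suc 0). ?\<phi> v = 0} = \<phi> (Suc 0) ` P (Suc (Suc 0))"
    and \<phi>1: "module_hom vscale vscale (\<phi> 1)"
    using res unfolding exact_resolution_def by auto
  then have ker1: "{v \<in> P (Suc 0). ?\<phi> v = 0} = {0}"
    using P(2)[of 2] module_hom.zero[OF \<phi>1] by (simp add: numeral_2_eq_2)
  have sub: "free_module.subspace (P i)" for i
    using P(1) unfolding projective_submodule_def by blast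
  interpret \<epsilon>: module_hom vscale "(*)" \<epsilon> by fact
  interpret \<pi>: module_hom vscale vscale \<pi> by fact
  interpret \<delta>: module_hom vscale "(*)" \<delta> by fact
  interpret \<phi>: module_hom vscale vscale ?\<phi> by fact
  let ?F0 = "free_submodule m" and ?F1 = "free_submodule r"
  have \<epsilon>\<pi>: "\<pi> x \<in> ?F0" "\<epsilon> (\<pi> x) = 0" if "x \<in> ?F1" for x
    using exact that by auto
  have \<delta>\<phi>: "?\<phi> x \<in> P 0" "\<delta> (?\<phi> x) = 0" if "x \<in> P (Suc 0)" for x
    using ker0 that by auto
  \<comment> \<open>Comparison maps \<open>f0, f1\<close> from the free presentation to the projective resolution
    and \<open>g0, g1\<close> back, all lying over the identity of \<open>I\<close>.\<close>
  obtain f0 where f0: "module_hom vscale vscale f0" "\<And>v. f0 v \<in> P 0" "\<And>v. v \<in> ?F0 \<Longrightarrow> \<delta> (f0 v) = \<epsilon> v"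
    using projective_lift[OF free_submodule_projective \<epsilon> \<delta> sub[of 0], of m] im surj by auto
  obtain g0 where g0: "module_hom vscale vscale g0" "\<And>v. g0 v \<in> ?F0" "\<And>v. v \<in> P 0 \<Longrightarrow> \<epsilon> (g0 v) = \<delta> v"
    using projective_lift[OF P(1) \<delta> \<epsilon> subspace_free_submodule, of 0 m] im surj by auto
  interpret f0: module_hom vscale vscale f0 by fact
  interpret g0: module_hom vscale vscale g0 by fact
  have "(f0 \<circ> \<pi>) ` ?F1 \<subseteq> ?\<phi> ` P (Suc 0)"
    using f0 \<epsilon>\<pi> by (auto simp flip: ker0)
  then obtain f1 where f1: "module_hom vscale vscale f1" "\<And>v. f1 v \<in> P (Suc 0)"
      "\<And>v. v \<in> ?F1 \<Longrightarrow> ?\<phi> (f1 v) = f0 (\<pi> v)"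
    using projective_lift[OF free_submodule_projective module_hom_compose[OF \<pi> f0(1)] \<phi> sub[of "Suc 0"], of r]
    by auto
  have "(g0 \<circ> ?\<phi>) ` P (Suc 0) \<subseteq> \<pi> ` ?F1"
    using g0 \<delta>\<phi> by (auto simp flip: exact)
  then obtain g1 where g1: "module_hom vscale vscale g1" "\<And>v. g1 v \<in> ?F1"
      "\<And>v. v \<in> P (Suc 0) \<Longrightarrow> \<pi> (g1 v) = g0 (?\<phi> v)"
    using projective_lift[OF P(1) module_hom_compose[OF \<phi> g0(1)] \<pi> subspace_free_submodule, of "Suc 0" r]
    by auto
  have gf: "module_hom vscale vscale (\<lambda>v. g0 (f0 v) - v)"
    by unfold_locales (simp_all add: f0.add g0.add f0.scale g0.scale
        free_module.scale_right_diff_distrib)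
  \<comment> \<open>A homotopy \<open>h\<close> between \<open>g0 \<circ> f0\<close> and the identity.\<close>
  have "(\<lambda>v. g0 (f0 v) - v) ` ?F0 \<subseteq> \<pi> ` ?F1"
    using f0 g0
    by (auto simp: \<epsilon>.diff intro!: free_module.subspace_diff[OF subspace_free_submodule]
        simp flip: exact)
  then obtain h where h: "module_hom vscale vscale h" "\<And>v. h v \<in> ?F1"
      "\<And>v. v \<in> ?F0 \<Longrightarrow> \<pi> (h v) = g0 (f0 v) - v"
    using projective_lift[OF free_submodule_projective gf \<pi> subspace_free_submodule, of m r] by auto
  interpret f1: module_hom vscale vscale f1 by fact
  interpret g1: module_hom vscale vscale g1 by fact
  interpret h: module_hom vscale vscale h by fact
  \<comment> \<open>In the next degree the homotopy identity holds only up to the kernel of \<open>\<pi>\<close>;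
    the defect \<open>\<kappa>\<close> is the identity on that kernel because \<open>f1\<close> kills it.\<close>
  let ?\<kappa> = "\<lambda>v. v + h (\<pi> v) - g1 (f1 v)"
  let ?K = "{v \<in> ?F1. \<pi> v = 0}"
  have hom: "module_hom vscale vscale ?\<kappa>"
    by (unfold_locales)
       (simp_all add: \<pi>.add h.add f1.add g1.add \<pi>.scale h.scale f1.scale g1.scale algebra_simps
        free_module.scale_right_distrib free_module.scale_right_diff_distrib)
  have into: "?\<kappa> x \<in> ?K" if "x \<in> ?F1" for x
  proof -
    have "\<pi> (?\<kappa> x) = 0"
      using that h(3)[OF \<epsilon>\<pi>(1)[OF that]] g1(3)[OF f1(2)] f1(3)[OF that] by (simp add: \<pi>.diff \<pi>.add)
    moreover have "?\<kappa> x \<in> ?F1"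
      by (intro free_module.subspace_diff free_module.subspace_add subspace_free_submodule that h g1)
    ultimately show ?thesis by simp
  qed
  have idem: "?\<kappa> x = x" if "x \<in> ?K" for x
  proof -
    have "?\<phi> (f1 x) = 0" using that f1(3) by simp
    then have "f1 x = 0" using ker1 f1(2) by blast
    then show ?thesis using that by simp
  qed
  show ?thesis
  proof (rule minimal_idempotent_trivial[OF hom, of ?K r])
    show "?\<kappa> (unit_vector k) \<in> ?K" if "k < r" for k
      by (rule into) (use that in simp)
  qed (use idem min v in auto)
qed

lemma projective_dimension_attained:
  assumes "projective_dimension I = enat n"
  shows "has_projective_resolution I n"
proof -
  let ?A = "{enat n |n. has_projective_resolution I n}"
  have "?A \<noteq> {}" using assms by (auto simp: projective_dimension_def Inf_enat_def split: if_splits)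
  then have "Inf ?A \<in> ?A" unfolding Inf_enat_def by (simp only: if_False) (meson LeastI ex_in_conv)
  then show ?thesis using assms by (auto simp: projective_dimension_def)
qed

section \<open>Monomials and monomial ideals\<close>

definition divides_exponent :: "'n exponent \<Rightarrow> 'n exponent \<Rightarrow> bool" (infix \<open>\<preceq>\<close> 50) where
  "a \<preceq> b \<longleftrightarrow> (\<forall>i. lookup a i \<le> lookup b i)"

lemma divides_exponent_refl [simp]: "a \<preceq> a"
  by (simp add: divides_exponent_def)

lemma divides_exponent_trans: "a \<preceq> b \<Longrightarrow> b \<preceq> c \<Longrightarrow> a \<preceq> c"
  unfolding divides_exponent_def using order_trans by blast

lemma divides_exponent_add [simp]: "a \<preceq> b + a" "a \<preceq> a + b"
  by (simp_all add: divides_exponent_def lookup_add)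

lemma divides_exponent_antisym: "a \<preceq> b \<Longrightarrow> b \<preceq> a \<Longrightarrow> a = b"
  unfolding divides_exponent_def by (intro poly_mapping_eqI antisym) auto

lemma divides_exponent_diff_add: "a \<preceq> b \<Longrightarrow> b - a + a = b"
  by (rule poly_mapping_eqI) (simp add: divides_exponent_def lookup_add lookup_minus)

lemma divides_exponent_iff: "a \<preceq> b \<longleftrightarrow> (\<exists>c. b = c + a)"
  using divides_exponent_diff_add divides_exponent_add by metis

lemma divides_exponent_same_degree:
  assumes "a \<preceq> b" "exponent_degree a = exponent_degree b"
  shows "a = b"
  using assms by (auto simp: divides_exponent_iff exponent_degree_add)

text \<open>All subtractions of exponents are truncated; these are the cases in which they behave like
  quotients of monomials.\<close>
lemma exponent_cancel:
  assumes "u \<preceq> (L :: 'n exponent)" "u \<preceq> M"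
  shows "L - u \<preceq> M - u \<longleftrightarrow> L \<preceq> M" "L \<preceq> M \<Longrightarrow> M - u - (L - u) = M - L"
    "L \<preceq> M \<Longrightarrow> M - L + (L - u) = M - u"
proof -
  have *: "lookup u i \<le> lookup L i" "lookup u i \<le> lookup M i" for i
    using assms by (auto simp: divides_exponent_def)
  show "L - u \<preceq> M - u \<longleftrightarrow> L \<preceq> M"
    using * by (simp add: divides_exponent_def lookup_minus le_diff_iff)
  assume "L \<preceq> M"
  then have LM: "lookup L i \<le> lookup M i" for i by (auto simp: divides_exponent_def)
  show "M - u - (L - u) = M - L"
    by (rule poly_mapping_eqI) (use * LM in \<open>simp add: lookup_minus\<close>)
  show "M - L + (L - u) = M - u"
    by (rule poly_mapping_eqI) (use * LM in \<open>simp add: lookup_minus lookup_add\<close>)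
qed

lemma lookup_mult_monom:
  fixes p :: "('n, 'k::field) mpoly"
  shows "lookup (p * monom u) M = (if u \<preceq> M then lookup p (M - u) else 0)"
proof -
  have "(lookup (monom u :: ('n, 'k) mpoly) q when M = l + q) = ((1 when M = l + u) when q = u)" for l q
    by (auto simp: monom_def lookup_single when_def)
  then have "lookup (p * monom u) M = (\<Sum>l. lookup p l * (1 when M = l + u))"
    unfolding lookup_mult by simp
  also have "\<dots> = (\<Sum>l. lookup p l when M = l + u)"
    by (intro arg_cong[of _ _ Sum_any]) (auto simp: when_def)
  also have "\<dots> = (if u \<preceq> M then lookup p (M - u) else 0)"
  proof (cases "u \<preceq> M")
    case True
    then have "M = l + u \<longleftrightarrow> l = M - u" for l
      using divides_exponent_diff_add by force
    then show ?thesis using True by simp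
  qed (auto simp: divides_exponent_iff)
  finally show ?thesis .
qed

lemma monom_mult: "monom a * monom b = monom (a + b)"
  by (simp add: monom_def mult_single)

lemma lookup_monom: "lookup (monom a) b = (if a = b then 1 else 0)"
  by (simp add: monom_def lookup_single when_def)

lemma keys_monom: "keys (monom a) = {a}"
  by (simp add: monom_def)

lemma lookup_const_mult: "lookup (single 0 c * p) M = c * lookup p M"
  for p :: "('n, 'k::field) mpoly"
proof -
  have "lookup (Poly_Mapping.map ((*) c) p) M = c * lookup p M"
    by transfer (simp add: when_def)
  then show ?thesis by (simp add: mult_map_scale_conv_mult)
qed

lemma const_mult_monom: "single 0 c * monom t = single t c"
  by (simp add: monom_def mult_single)

lemma lookup_mult_single:
  fixes p :: "('n, 'k::field) mpoly"
  shows "lookup (p * single t c) W = c * (if t \<preceq> W then lookup p (W - t) else 0)"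
proof -
  have "p * single t c = single 0 c * (p * monom t)"
    by (metis const_mult_monom mult.left_commute)
  then show ?thesis by (simp add: lookup_const_mult lookup_mult_monom)
qed

lemma sum_keys_single: "p = (\<Sum>M\<in>keys p. single M (lookup p M))"
  by (rule poly_mapping_eqI) (auto simp: lookup_sum lookup_single when_def in_keys_iff)

text \<open>A monomial ideal contains a polynomial if and only if it contains all its monomials, because
  the polynomials with this property form an ideal.\<close>
lemma in_monomial_ideal_iff:
  fixes p :: "('n, 'k::field) mpoly"
  shows "p \<in> ideal_generated (monom ` G) \<longleftrightarrow> (\<forall>M\<in>keys p. \<exists>u\<in>G. u \<preceq> M)"
proof
  let ?P = "{p :: ('n, 'k) mpoly. \<forall>M\<in>keys p. \<exists>u\<in>G. u \<preceq> M}"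
  have "ring_module.subspace ?P"
  proof (rule ring_module.subspaceI)
    fix x y assume "x \<in> ?P" "y \<in> ?P"
    then show "x + y \<in> ?P" using Poly_Mapping.keys_add[of x y] by blast
  next
    fix c x assume x: "x \<in> ?P"
    show "c * x \<in> ?P"
    proof (intro CollectI ballI)
      fix M assume "M \<in> keys (c * x)"
      then obtain a b where "b \<in> keys x" "M = a + b" by (rule keys_multE)
      then show "\<exists>u\<in>G. u \<preceq> M"
        using x divides_exponent_trans divides_exponent_add(1) by blast
    qed
  qed auto
  moreover have "monom ` G \<subseteq> ?P"
    by (auto simp: monom_def intro: divides_exponent_refl)
  ultimately have "ideal_generated (monom ` G) \<subseteq> ?P"
    by (intro ring_module.span_minimal)
  then show "p \<in> ideal_generated (monom ` G) \<Longrightarrow> \<forall>M\<in>keys p. \<exists>u\<in>G. u \<preceq> M" by blast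
next
  assume *: "\<forall>M\<in>keys p. \<exists>u\<in>G. u \<preceq> M"
  have "single M (lookup p M) \<in> ideal_generated (monom ` G)" if M: "M \<in> keys p" for M
  proof -
    obtain u where u: "u \<in> G" "u \<preceq> M" using * M by blast
    then have "single M (lookup p M) = single (M - u) (lookup p M) * monom u"
      by (simp add: monom_def mult_single divides_exponent_diff_add)
    then show ?thesis
      using u(1) by (simp add: ring_module.span_scale ring_module.span_base)
  qed
  then have "(\<Sum>M\<in>keys p. single M (lookup p M)) \<in> ideal_generated (monom ` G)"
    by (rule ring_module.span_sum)
  then show "p \<in> ideal_generated (monom ` G)" using sum_keys_single[of p] by simp
qed

text \<open>A monomial divisible by another one of the same degree equals it.\<close>
lemma equidegree_minimal_generators:
  fixes I :: "('n::finite, 'k::field) mpoly set"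
  assumes "I = ideal_generated (monom ` G)" "\<And>x. x \<in> G \<Longrightarrow> exponent_degree x = D"
  shows "minimal_monomial_generators I G"
  unfolding minimal_monomial_generators_def
proof (intro conjI allI impI notI)
  fix G' assume G': "G' \<subset> G" and eq: "ideal_generated (monom ` G') = I"
  then obtain y where y: "y \<in> G" "y \<notin> G'" by blast
  have "monom y \<in> (ideal_generated (monom ` G') :: ('n, 'k) mpoly set)"
    unfolding eq assms(1) using y(1) by (auto intro: ring_module.span_base)
  then obtain x where x: "x \<in> G'" "x \<preceq> y" by (auto simp: in_monomial_ideal_iff keys_monom)
  then have "x = y" using assms(2) G' y(1) by (intro divides_exponent_same_degree) auto
  then show False using x(1) y(2) by simp
qed (simp add: assms(1))

lemma finite_squarefree: "finite {x :: 'n::finite exponent. squarefree_exponent x}"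
proof (rule inj_on_finite)
  show "inj_on (\<lambda>x :: 'n exponent. {i. lookup x i = 1}) {x. squarefree_exponent x}"
  proof (rule inj_onI, rule poly_mapping_eqI)
    fix x y :: "'n exponent" and i
    assume *: "x \<in> {x. squarefree_exponent x}" "y \<in> {x. squarefree_exponent x}"
      "{i. lookup x i = 1} = {i. lookup y i = 1}"
    have "lookup x i \<le> 1" "lookup y i \<le> 1"
      using * by (auto simp: squarefree_exponent_def)
    moreover have "lookup x i = 1 \<longleftrightarrow> lookup y i = 1" using *(3) by blast
    ultimately show "lookup x i = lookup y i" by linarith
  qed
qed auto

lemma squarefree_minimal_generators:
  fixes I :: "('n::finite, 'k::field) mpoly set"
  assumes "squarefree_monomial_ideal I"
  obtains us where "distinct us" "\<And>x. x \<in> set us \<Longrightarrow> squarefree_exponent x"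
    "I = ideal_generated (monom ` set us)"
    "\<And>x y. x \<in> set us \<Longrightarrow> y \<in> set us \<Longrightarrow> x \<preceq> y \<Longrightarrow> x = y"
proof -
  obtain G where G: "\<forall>m\<in>G. squarefree_exponent m" "I = ideal_generated (monom ` G)"
    using assms by (auto simp: squarefree_monomial_ideal_def)
  let ?P = "\<lambda>H. H \<subseteq> G \<and> I = ideal_generated (monom ` H)"
  obtain H where H: "?P H" "\<And>H'. ?P H' \<Longrightarrow> card H \<le> card H'"
    using ex_has_least_nat[of ?P G card] G(2) by blast
  have "finite H" using finite_subset[OF _ finite_squarefree] G(1) H(1) by blast
  then obtain us where us: "distinct us" "set us = H" using finite_distinct_list by blast
  have "x = y" if xy: "x \<in> H" "y \<in> H" "x \<preceq> y" for x y
  proof (rule ccontr)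
    assume "x \<noteq> y"
    then have "(\<exists>u\<in>H - {y}. u \<preceq> M) \<longleftrightarrow> (\<exists>u\<in>H. u \<preceq> M)" for M
      using xy divides_exponent_trans by blast
    then have "ideal_generated (monom ` (H - {y})) = (ideal_generated (monom ` H) :: ('n, 'k) mpoly set)"
      by (intro set_eqI) (simp add: in_monomial_ideal_iff)
    then have "card H \<le> card (H - {y})" using H by (intro H(2)) auto
    then show False using card_Diff1_less[OF \<open>finite H\<close> xy(2)] by simp
  qed
  then show thesis using that[of us] us G(1) H(1) by blast
qed

section \<open>Syzygies between pairs of monomials\<close>

text \<open>The presentation \<open>e_k \<mapsto> x^(u k)\<close> of the monomial ideal generated by the \<open>u k\<close>.\<close>
definition augmentation ::
  "(nat \<Rightarrow> 'n exponent) \<Rightarrow> (nat \<Rightarrow>\<^sub>0 ('n, 'k::field) mpoly) \<Rightarrow> ('n, 'k) mpoly" where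
  "augmentation u = extend_linearly (*) (\<lambda>k. monom (u k))"

definition syzygies :: "(nat \<Rightarrow> 'n exponent) \<Rightarrow> nat \<Rightarrow> (nat \<Rightarrow>\<^sub>0 ('n, 'k::field) mpoly) set" where
  "syzygies u m = {f \<in> free_submodule m. augmentation u f = 0}"

text \<open>The truncated difference \<open>u b - u a\<close> is the exponent of the least common multiple of \<open>u a\<close>
  and \<open>u b\<close> divided by \<open>u a\<close>.\<close>
definition pair_syzygy ::
  "(nat \<Rightarrow> 'n exponent) \<Rightarrow> nat \<times> nat \<Rightarrow> (nat \<Rightarrow>\<^sub>0 ('n, 'k::field) mpoly)" where
  "pair_syzygy u = (\<lambda>(a, b). single a (monom (u b - u a)) - single b (monom (u a - u b)))"

lemma augmentation_hom: "module_hom vscale (*) (augmentation u)"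
  unfolding augmentation_def by (rule ring_module.extend_linearly_hom)

lemma augmentation_free:
  "f \<in> free_submodule m \<Longrightarrow> augmentation u f = (\<Sum>k<m. lookup f k * monom (u k))"
  unfolding augmentation_def by (rule ring_module.extend_linearly_free)

lemma augmentation_single [simp]: "augmentation u (single k p) = p * monom (u k)"
  by (simp add: augmentation_def extend_linearly_def)

lemma image_augmentation:
  "augmentation u ` free_submodule m = ideal_generated (monom ` u ` {..<m})"
  unfolding augmentation_def ring_module.image_extend_linearly by (simp add: image_image)

lemma subspace_syzygies:
  "free_module.subspace (syzygies u m :: (nat \<Rightarrow>\<^sub>0 ('n, 'k::field) mpoly) set)"
proof -
  interpret h: module_hom vscale "(*)" "augmentation u :: _ \<Rightarrow> ('n, 'k) mpoly"
    by (rule augmentation_hom)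
  have "(syzygies u m :: (nat \<Rightarrow>\<^sub>0 ('n, 'k) mpoly) set) = free_submodule m \<inter> {f. augmentation u f = 0}"
    by (auto simp: syzygies_def)
  then show ?thesis
    using free_module.subspace_inter[OF subspace_free_submodule[of m] h.subspace_kernel] by simp
qed

lemma pair_syzygy_flip: "pair_syzygy u (b, a) = - pair_syzygy u (a, b)"
  by (simp add: pair_syzygy_def)

lemma binomial_syzygy:
  assumes "k < m" "k' < m" "w + u k = w' + u k'"
  shows "single k (monom w) - single k' (monom w') \<in> syzygies u m"
proof -
  interpret h: module_hom vscale "(*)" "augmentation u" by (rule augmentation_hom)
  have "single k (monom w) - single k' (monom w') \<in> free_submodule m"
    using assms(1,2)
    by (intro free_module.subspace_diff[OF subspace_free_submodule] single_free_submodule)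
  then show ?thesis
    using assms(3) by (simp add: syzygies_def h.diff monom_mult)
qed

lemma pair_syzygy_in_syzygies: "a < m \<Longrightarrow> b < m \<Longrightarrow> pair_syzygy u (a, b) \<in> syzygies u m"
  unfolding pair_syzygy_def prod.case
  by (rule binomial_syzygy) (auto simp: lookup_add lookup_minus intro!: poly_mapping_eqI)

lemma vscale_single: "vscale p (single k q) = single k (p * q)"
  by (rule poly_mapping_eqI) (simp add: lookup_single when_def)

lemma binomial_syzygy_multiple:
  assumes "w + u k = w' + u k'"
  shows "single k (monom w) - single k' (monom w')
       = vscale (monom (w - (u k' - u k))) (pair_syzygy u (k, k'))"
proof -
  have *: "lookup w i + lookup (u k) i = lookup w' i + lookup (u k') i" for i
    using arg_cong[OF assms, of "\<lambda>v. lookup v i"] by (simp add: lookup_add)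
  have "w - (u k' - u k) + (u k' - u k) = w"
  proof (rule poly_mapping_eqI)
    fix i
    show "lookup (w - (u k' - u k) + (u k' - u k)) i = lookup w i"
      using *[of i] unfolding lookup_add lookup_minus by linarith
  qed
  moreover have "w - (u k' - u k) + (u k - u k') = w'"
  proof (rule poly_mapping_eqI)
    fix i
    show "lookup (w - (u k' - u k) + (u k - u k')) i = lookup w' i"
      using *[of i] unfolding lookup_add lookup_minus by linarith
  qed
  ultimately show ?thesis
    by (simp add: pair_syzygy_def free_module.scale_right_diff_distrib vscale_single monom_mult)
qed

text \<open>In a syzygy, every term is cancelled by a term of the same multidegree in another position.
  Subtracting a multiple of the corresponding binomial syzygy removes a term, so every syzygy is a
  combination of binomial ones. The predicate \<open>Q\<close> keeps track of the multidegrees that occur, so that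
  syzygies with linear entries are seen to need only the pairs with linear syzygies.\<close>
lemma syzygy_in_binomial_span:
  fixes f :: "nat \<Rightarrow>\<^sub>0 ('n, 'k::field) mpoly"
  assumes N: "free_module.subspace N"
    and binom: "\<And>k k' w w'. k < m \<Longrightarrow> k' < m \<Longrightarrow> k \<noteq> k' \<Longrightarrow> w + u k = w' + u k' \<Longrightarrow> Q (w + u k)
      \<Longrightarrow> single k (monom w) - single k' (monom w') \<in> N"
    and "f \<in> syzygies u m"
    and "\<And>k w. k < m \<Longrightarrow> w \<in> keys (lookup f k) \<Longrightarrow> Q (w + u k)"
  shows "f \<in> N"
  using assms(3,4)
proof (induction "\<Sum>k<m. card (keys (lookup f k))" arbitrary: f rule: less_induct)
  case less
  have free: "f \<in> free_submodule m" using less.prems(1) by (simp add: syzygies_def)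
  show ?case
  proof (cases "\<exists>k<m. lookup f k \<noteq> 0")
    case False
    then have "lookup f k = 0" for k
      using free by (cases "k < m") (auto simp: free_submodule_def in_keys_iff subset_iff)
    then have "f = 0" by (simp add: poly_mapping_eqI)
    then show ?thesis using free_module.subspace_0[OF N] by simp
  next
    case True
    then obtain k w where k: "k < m" and w: "w \<in> keys (lookup f k)"
      by (metis equals0I keys_eq_empty poly_mapping_eqI in_keys_iff lookup_zero)
    define c where "c = lookup (lookup f k) w"
    have c: "c \<noteq> 0" using w by (simp add: c_def in_keys_iff)
    \<comment> \<open>The term \<open>w\<close> at position \<open>k\<close> contributes to the monomial \<open>M\<close> of the augmentation,
      so some other position must contribute to \<open>M\<close> as well to cancel it.\<close>
    let ?M = "w + u k"
    let ?term = "\<lambda>k. if u k \<preceq> ?M then lookup (lookup f k) (?M - u k) else 0"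
    have "(\<Sum>k<m. ?term k) = lookup (augmentation u f) ?M"
      by (simp add: augmentation_free[OF free] lookup_sum lookup_mult_monom)
    then have "(\<Sum>k<m. ?term k) = 0"
      using less.prems(1) by (simp add: syzygies_def)
    moreover have "(\<Sum>k<m. ?term k) = ?term k + (\<Sum>k\<in>{..<m} - {k}. ?term k)"
      using k by (intro sum.remove) auto
    moreover have "?term k = c" by (simp add: c_def)
    ultimately have "(\<Sum>k\<in>{..<m} - {k}. ?term k) \<noteq> 0" using c by auto
    then obtain k' where "k' \<in> {..<m} - {k}" and term': "?term k' \<noteq> 0"
      by (rule sum.not_neutral_contains_not_neutral)
    then have k': "k' < m" "k' \<noteq> k" by auto
    define w' where "w' = ?M - u k'"
    have M: "w + u k = w' + u k'"
      using term' divides_exponent_diff_add[of "u k'" ?M] by (auto simp: w'_def split: if_splits)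
    have w': "w' \<in> keys (lookup f k')"
      using term' by (auto simp: w'_def in_keys_iff split: if_splits)
    define g where "g = single k (monom w) - single k' (monom w' :: ('n, 'k) mpoly)"
    define f' where "f' = f - vscale (single 0 c) g"
    have g: "g \<in> syzygies u m" unfolding g_def by (rule binomial_syzygy) (use k k' M in auto)
    have f': "f' \<in> syzygies u m"
      unfolding f'_def using less.prems(1) g
      by (intro free_module.subspace_diff free_module.subspace_scale subspace_syzygies)
    have look: "lookup (lookup f' l) v = lookup (lookup f l) v
        - c * ((if l = k \<and> v = w then 1 else 0) - (if l = k' \<and> v = w' then 1 else 0))" for l v
      by (simp add: f'_def g_def lookup_minus lookup_const_mult lookup_single lookup_monom when_def)
    have sub: "keys (lookup f' l) \<subseteq> keys (lookup f l)" for l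
      using w w' by (auto simp: in_keys_iff look c_def split: if_splits)
    have "w \<notin> keys (lookup f' k)"
      using k'(2) by (simp add: in_keys_iff look c_def)
    then have "keys (lookup f' k) \<subset> keys (lookup f k)"
      using sub[of k] w by blast
    then have "card (keys (lookup f' k)) < card (keys (lookup f k))"
      by (rule psubset_card_mono[rotated]) simp
    then have "(\<Sum>k<m. card (keys (lookup f' k))) < (\<Sum>k<m. card (keys (lookup f k)))"
      using k sub by (intro sum_strict_mono_ex1) (auto intro!: card_mono)
    then have "f' \<in> N"
      using f' less.prems(2) sub by (intro less.hyps) auto
    moreover have "g \<in> N"
      unfolding g_def using k k'(1) k'(2)[symmetric] M less.prems(2)[OF k w] by (rule binom)
    ultimately have "f' + vscale (single 0 c) g \<in> N"
      by (intro free_module.subspace_add free_module.subspace_scale N)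
    then show ?thesis by (simp add: f'_def)
  qed
qed

lemma binomial_in_span_pairs:
  assumes "w + u k = w' + u k'" "(k, k') \<in> D \<or> (k', k) \<in> D"
  shows "single k (monom w) - single k' (monom w') \<in> free_module.span (pair_syzygy u ` D)"
proof -
  have "pair_syzygy u (k, k') \<in> free_module.span (pair_syzygy u ` D)"
    using assms(2) pair_syzygy_flip[of u k k']
    by (metis free_module.span_base free_module.span_neg image_eqI minus_minus)
  then show ?thesis
    unfolding binomial_syzygy_multiple[OF assms(1)] by (rule free_module.span_scale)
qed

lemma span_pairs_eq_syzygies:
  fixes u :: "nat \<Rightarrow> 'n exponent"
  shows "free_module.span (pair_syzygy u ` {(a, b). a < b \<and> b < m})
       = (syzygies u m :: (nat \<Rightarrow>\<^sub>0 ('n, 'k::field) mpoly) set)"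
proof (rule antisym)
  show "free_module.span (pair_syzygy u ` {(a, b). a < b \<and> b < m})
      \<subseteq> (syzygies u m :: (nat \<Rightarrow>\<^sub>0 ('n, 'k) mpoly) set)"
    by (rule free_module.span_minimal)
       (auto intro!: pair_syzygy_in_syzygies subspace_syzygies)
  show "(syzygies u m :: (nat \<Rightarrow>\<^sub>0 ('n, 'k) mpoly) set)
      \<subseteq> free_module.span (pair_syzygy u ` {(a, b). a < b \<and> b < m})"
  proof
    fix f :: "nat \<Rightarrow>\<^sub>0 ('n, 'k) mpoly" assume f: "f \<in> syzygies u m"
    show "f \<in> free_module.span (pair_syzygy u ` {(a, b). a < b \<and> b < m})"
    proof (rule syzygy_in_binomial_span[where Q = "\<lambda>_. True", OF _ _ f])
      fix k k' w w' assume "k < m" "k' < m" "k \<noteq> k'" "w + u k = w' + u k'"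
      then show "single k (monom w) - single k' (monom w' :: ('n, 'k) mpoly)
          \<in> free_module.span (pair_syzygy u ` {(a, b). a < b \<and> b < m})"
        by (intro binomial_in_span_pairs) auto
    qed auto
  qed
qed

section \<open>Bases of pair syzygies\<close>

definition pair_lcm :: "(nat \<Rightarrow> 'n exponent) \<Rightarrow> nat \<times> nat \<Rightarrow> 'n exponent" where
  "pair_lcm u e = u (fst e) + (u (snd e) - u (fst e))"

text \<open>The signed incidence matrix of a graph with edges \<open>e\<close>: pair syzygies with all variables set to
  \<open>1\<close>.\<close>
definition incidence :: "nat \<times> nat \<Rightarrow> nat \<Rightarrow> 'k::field" where
  "incidence e k = (if k = fst e then 1 else if k = snd e then -1 else 0)"

lemma lookup_pair_lcm: "lookup (pair_lcm u (a, b)) i = max (lookup (u a) i) (lookup (u b) i)"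
  by (simp add: pair_lcm_def lookup_add lookup_minus)

lemma pair_lcm_upper: "u (fst e) \<preceq> pair_lcm u e" "u (snd e) \<preceq> pair_lcm u e"
  by (cases e; simp add: divides_exponent_def lookup_pair_lcm)+

lemma pair_lcm_least: "u a \<preceq> M \<Longrightarrow> u b \<preceq> M \<Longrightarrow> pair_lcm u (a, b) \<preceq> M"
  by (simp add: divides_exponent_def lookup_pair_lcm)

lemma incidence_divides: "incidence e k \<noteq> 0 \<Longrightarrow> u k \<preceq> pair_lcm u e"
  using pair_lcm_upper[of u e] by (auto simp: incidence_def split: if_splits)

lemma lookup_pair_syzygy:
  assumes "fst e \<noteq> snd e"
  shows "lookup (pair_syzygy u e) k = single (pair_lcm u e - u k) (incidence e k)"
proof -
  have "pair_lcm u e - u (fst e) = u (snd e) - u (fst e)"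
    "pair_lcm u e - u (snd e) = u (fst e) - u (snd e)"
    by (cases e; rule poly_mapping_eqI; simp add: lookup_minus lookup_pair_lcm max_def)+
  then show ?thesis
    using assms
    by (auto simp: pair_syzygy_def incidence_def lookup_minus lookup_single when_def monom_def
        single_uminus split: prod.splits)
qed

text \<open>A relation between pair syzygies, taken in a single multidegree \<open>M\<close>, is a relation between the
  columns of the incidence matrix over the field.\<close>
lemma relation_coefficients:
  fixes h :: "nat \<times> nat \<Rightarrow> ('n, 'k::field) mpoly"
  assumes E: "\<And>e. e \<in> E \<Longrightarrow> fst e \<noteq> snd e"
    and rel: "(\<Sum>e\<in>E. vscale (h e) (pair_syzygy u e)) = 0"
  shows "(\<Sum>e\<in>E. (if pair_lcm u e \<preceq> M then lookup (h e) (M - pair_lcm u e) else 0) * incidence e k) = 0"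
proof (cases "u k \<preceq> M")
  case True
  have "lookup (h e * lookup (pair_syzygy u e) k) (M - u k)
      = (if pair_lcm u e \<preceq> M then lookup (h e) (M - pair_lcm u e) else 0) * incidence e k"
    if "e \<in> E" for e
  proof (cases "incidence e k = (0 :: 'k)")
    case False
    then have "u k \<preceq> pair_lcm u e" by (rule incidence_divides)
    then show ?thesis
      using exponent_cancel[OF _ True] E[OF that]
      by (simp add: lookup_pair_syzygy lookup_mult_single)
  qed (use E[OF that] in \<open>simp add: lookup_pair_syzygy\<close>)
  then have "(\<Sum>e\<in>E. (if pair_lcm u e \<preceq> M then lookup (h e) (M - pair_lcm u e) else 0) * incidence e k)
      = lookup (lookup (\<Sum>e\<in>E. vscale (h e) (pair_syzygy u e)) k) (M - u k)"
    by (simp add: lookup_sum)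
  then show ?thesis by (simp add: rel)
next
  case False
  then have "\<not> pair_lcm u e \<preceq> M" if "incidence e k \<noteq> (0 :: 'k)" for e
    using incidence_divides[OF that, of u] divides_exponent_trans by blast
  then show ?thesis by (intro sum.neutral) (metis mult_eq_0_iff)
qed

text \<open>The reverse passage: a relation over the field is homogenized in a multidegree \<open>M\<close> that all
  the least common multiples concerned divide.\<close>
lemma relation_from_coefficients:
  fixes c :: "nat \<times> nat \<Rightarrow> 'k::field" and u :: "nat \<Rightarrow> 'n exponent"
  assumes E: "\<And>e. e \<in> E \<Longrightarrow> fst e \<noteq> snd e"
    and c: "\<And>k. (\<Sum>e\<in>E. c e * incidence e k) = 0"
    and M: "\<And>e. e \<in> E \<Longrightarrow> c e \<noteq> 0 \<Longrightarrow> pair_lcm u e \<preceq> M"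
  shows "(\<Sum>e\<in>E. vscale (single (M - pair_lcm u e) (c e)) (pair_syzygy u e)) = 0"
proof (rule poly_mapping_eqI)
  fix k
  have "single (M - pair_lcm u e) (c e) * lookup (pair_syzygy u e) k
      = single (M - u k) (c e * incidence e k)" if e: "e \<in> E" for e
  proof (cases "c e * incidence e k = 0")
    case False
    then have "u k \<preceq> pair_lcm u e" "pair_lcm u e \<preceq> M"
      using incidence_divides[of e k u] M[OF e] by auto
    then have "M - pair_lcm u e + (pair_lcm u e - u k) = M - u k"
      using divides_exponent_trans exponent_cancel(3) by blast
    then show ?thesis using E[OF e] by (simp add: lookup_pair_syzygy mult_single)
  qed (use E[OF e] in \<open>auto simp: lookup_pair_syzygy\<close>)
  then have "lookup (\<Sum>e\<in>E. vscale (single (M - pair_lcm u e) (c e)) (pair_syzygy u e)) k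
      = (\<Sum>e\<in>E. single (M - u k) (c e * incidence e k))"
    by (simp add: lookup_sum)
  also have "\<dots> = single (M - u k) (\<Sum>e\<in>E. c e * incidence e k)"
    by (rule poly_mapping_eqI) (simp add: lookup_sum lookup_single when_def)
  finally show "lookup (\<Sum>e\<in>E. vscale (single (M - pair_lcm u e) (c e)) (pair_syzygy u e)) k
      = lookup 0 k" by (simp add: c)
qed

text \<open>If a coefficient of a relation had a nonzero constant term, its syzygy would be a combination of
  the others: this is seen in the multidegree of that syzygy.\<close>
lemma minimal_pairs_relation:
  fixes h :: "nat \<times> nat \<Rightarrow> ('n, 'k::field) mpoly"
  assumes E: "\<And>e. e \<in> E \<Longrightarrow> fst e \<noteq> snd e" and fin: "finite E"
    and min: "(pair_syzygy u e0 :: nat \<Rightarrow>\<^sub>0 ('n, 'k) mpoly)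
      \<notin> free_module.span (pair_syzygy u ` (E - {e0}))"
    and rel: "(\<Sum>e\<in>E. vscale (h e) (pair_syzygy u e)) = 0"
    and e0: "e0 \<in> E"
  shows "lookup (h e0) 0 = 0"
proof (rule ccontr)
  \<comment> \<open>The part of the relation in the multidegree of \<open>e0\<close> has a constant coefficient at \<open>e0\<close>.\<close>
  define M where "M = pair_lcm u e0"
  define c where "c e = (if pair_lcm u e \<preceq> M then lookup (h e) (M - pair_lcm u e) else 0)" for e
  assume "lookup (h e0) 0 \<noteq> 0"
  then have c0: "c e0 \<noteq> 0" by (simp add: c_def M_def)
  have "(\<Sum>e\<in>E. c e * incidence e k) = 0" for k
    unfolding c_def by (rule relation_coefficients[OF E rel])
  then have "(\<Sum>e\<in>E. vscale (single (M - pair_lcm u e) (c e)) (pair_syzygy u e)) = 0"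
    by (intro relation_from_coefficients[OF E]) (auto simp: c_def split: if_splits)
  then have "vscale (single 0 (c e0)) (pair_syzygy u e0)
      + (\<Sum>e\<in>E - {e0}. vscale (single (M - pair_lcm u e) (c e)) (pair_syzygy u e)) = 0"
    unfolding sum.remove[OF fin e0] by (simp add: M_def)
  then have "vscale (single 0 (c e0)) (pair_syzygy u e0)
      = - (\<Sum>e\<in>E - {e0}. vscale (single (M - pair_lcm u e) (c e)) (pair_syzygy u e))"
    by (simp add: eq_neg_iff_add_eq_0)
  also have "\<dots> \<in> free_module.span (pair_syzygy u ` (E - {e0}))"
    by (intro free_module.span_neg free_module.span_sum free_module.span_scale
        free_module.span_base imageI)
  finally have "vscale (single 0 (inverse (c e0))) (vscale (single 0 (c e0)) (pair_syzygy u e0))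
      \<in> free_module.span (pair_syzygy u ` (E - {e0}))"
    by (rule free_module.span_scale)
  then show False
    using min c0 by (simp add: mult_single)
qed

text \<open>A generating subset of least cardinality gives a minimal presentation, which is
  injective in projective dimension one.\<close>
lemma pair_syzygy_basis:
  fixes I :: "('n::finite, 'k::field) mpoly set" and u :: "nat \<Rightarrow> 'n exponent"
  assumes pd: "has_projective_resolution I 1"
    and I: "I = ideal_generated (monom ` u ` {..<m})"
    and D: "D \<subseteq> {(a, b). a < b \<and> b < m}"
    and gen: "free_module.span (pair_syzygy u ` D) = (syzygies u m :: (nat \<Rightarrow>\<^sub>0 ('n, 'k) mpoly) set)"
  obtains E where "E \<subseteq> D"
    "free_module.span (pair_syzygy u ` E) = (syzygies u m :: (nat \<Rightarrow>\<^sub>0 ('n, 'k) mpoly) set)"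
    "\<forall>h. (\<Sum>e\<in>E. vscale (h e) (pair_syzygy u e :: nat \<Rightarrow>\<^sub>0 ('n, 'k) mpoly)) = 0 \<longrightarrow>
      (\<forall>e\<in>E. h e = 0)"
proof -
  let ?gen = "\<lambda>E. E \<subseteq> D \<and>
    free_module.span (pair_syzygy u ` E) = (syzygies u m :: (nat \<Rightarrow>\<^sub>0 ('n, 'k) mpoly) set)"
  obtain E where E: "?gen E" "\<And>E'. ?gen E' \<Longrightarrow> card E \<le> card E'"
    using ex_has_least_nat[of ?gen D card] gen by blast
  have "D \<subseteq> {..<m} \<times> {..<m}" using D by auto
  then have "finite D" by (rule finite_subset) simp
  then have fin: "finite E" using E(1) finite_subset by blast
  have ne: "fst e \<noteq> snd e" if "e \<in> E" for e using that E(1) D by auto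
  have min: "pair_syzygy u e \<notin> (free_module.span (pair_syzygy u ` (E - {e})) :: (nat \<Rightarrow>\<^sub>0 ('n, 'k) mpoly) set)"
    if e: "e \<in> E" for e
  proof
    let ?N = "free_module.span (pair_syzygy u ` (E - {e})) :: (nat \<Rightarrow>\<^sub>0 ('n, 'k) mpoly) set"
    assume *: "pair_syzygy u e \<in> ?N"
    have "pair_syzygy u x \<in> ?N" if "x \<in> E" for x
      using * that by (cases "x = e") (auto intro: free_module.span_base)
    then have "free_module.span (pair_syzygy u ` E) \<subseteq> ?N"
      by (intro free_module.span_minimal) auto
    then have "free_module.span (pair_syzygy u ` E) = ?N"
      by (rule antisym) (intro free_module.span_mono image_mono, auto)
    then have "card E \<le> card (E - {e})"
      using E(1) by (intro E(2) conjI) (blast, metis)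
    then show False using e fin by (metis card_Diff1_less not_less)
  qed
  obtain es where es: "set es = E" "distinct es" using finite_distinct_list[OF fin] by blast
  let ?r = "length es"
  define \<pi> where "\<pi> = extend_linearly vscale (\<lambda>j. pair_syzygy u (es ! j) :: nat \<Rightarrow>\<^sub>0 ('n, 'k) mpoly)"
  have ker: "v = 0" if v: "v \<in> free_submodule ?r" "\<pi> v = 0" for v
  proof (rule minimal_presentation_injective[OF pd augmentation_hom])
    show "module_hom vscale vscale \<pi>"
      unfolding \<pi>_def by (rule free_module.extend_linearly_hom)
    show "augmentation u ` free_submodule m = I"
      unfolding I by (rule image_augmentation)
    show "{v \<in> free_submodule m. augmentation u v = 0} = \<pi> ` free_submodule ?r"
      unfolding \<pi>_def free_module.image_extend_linearly_list es(1)
      using E(1) by (simp add: syzygies_def)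
    fix v l assume v: "v \<in> free_submodule ?r" "\<pi> v = 0"
    show "lookup (lookup v l) 0 = 0"
    proof (cases "l < ?r")
      case True
      obtain h where h: "\<And>j. j < ?r \<Longrightarrow> h (es ! j) = lookup v j"
        using list_coefficients[OF es(2)] by blast
      have "es ! l \<in> E" using True es by auto
      moreover have "(\<Sum>e\<in>E. vscale (h e) (pair_syzygy u e)) = 0"
        using free_module.extend_linearly_list[OF es(2) v(1) h, of "pair_syzygy u"] v(2)
        by (simp add: \<pi>_def es(1))
      ultimately have "lookup (h (es ! l)) 0 = 0"
        using ne fin min by (intro minimal_pairs_relation[of E u]) auto
      then show ?thesis by (simp add: h True)
    next
      case False
      then have "lookup v l = 0" using v by (auto simp: free_submodule_def in_keys_iff)
      then show ?thesis by simp
    qed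
  qed (use v in auto)
  show thesis
  proof (rule that)
    show "\<forall>h. (\<Sum>e\<in>E. vscale (h e) (pair_syzygy u e :: nat \<Rightarrow>\<^sub>0 ('n, 'k) mpoly)) = 0 \<longrightarrow>
        (\<forall>e\<in>E. h e = 0)"
      using free_module.independent_list_iff[OF es(2), of "pair_syzygy u :: _ \<Rightarrow> nat \<Rightarrow>\<^sub>0 ('n, 'k) mpoly"]
        ker
      unfolding es(1) \<pi>_def by blast
  qed (use E in blast)+
qed

section \<open>The minimal graded free resolution\<close>

text \<open>The resolution ends after one step, with a basis of pair syzygies. It is minimal since no
  generator divides another one, so that no entry of a pair syzygy has a constant term.\<close>
lemma exists_minimal_graded_free_resolution:
  fixes I :: "('n::finite, 'k::field) mpoly set" and u :: "nat \<Rightarrow> 'n exponent"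
  assumes pd: "has_projective_resolution I 1"
    and I: "I = ideal_generated (monom ` u ` {..<m})"
    and antichain: "\<And>k l. k < m \<Longrightarrow> l < m \<Longrightarrow> u k \<preceq> u l \<Longrightarrow> k = l"
  shows "\<exists>a \<epsilon> \<phi>. minimal_graded_free_resolution I a \<epsilon> \<phi>"
proof -
  obtain E where E: "E \<subseteq> {(a, b). a < b \<and> b < m}"
      "free_module.span (pair_syzygy u ` E) = (syzygies u m :: (nat \<Rightarrow>\<^sub>0 ('n, 'k) mpoly) set)"
    and indep: "\<forall>h. (\<Sum>e\<in>E. vscale (h e) (pair_syzygy u e :: nat \<Rightarrow>\<^sub>0 ('n, 'k) mpoly)) = 0 \<longrightarrow>
      (\<forall>e\<in>E. h e = 0)"
    by (rule pair_syzygy_basis[OF pd I order_refl span_pairs_eq_syzygies])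
  have "E \<subseteq> {..<m} \<times> {..<m}" using E by auto
  then have "finite E" by (rule finite_subset) simp
  then obtain es where es: "set es = E" "distinct es" using finite_distinct_list by blast
  let ?r = "length es"
  let ?\<sigma> = "\<lambda>j. pair_syzygy u (es ! j) :: nat \<Rightarrow>\<^sub>0 ('n, 'k) mpoly"
  define \<pi> where "\<pi> = extend_linearly vscale ?\<sigma>"
  have \<pi>: "module_hom vscale vscale \<pi>"
    unfolding \<pi>_def by (rule free_module.extend_linearly_hom)
  have edge: "fst (es ! j) < snd (es ! j)" "snd (es ! j) < m" if "j < ?r" for j
    using E(1) es(1) that nth_mem by force+
  have ker: "v = 0" if "v \<in> free_submodule ?r" "\<pi> v = 0" for v
    using free_module.independent_list_iff[OF es(2), of "pair_syzygy u :: _ \<Rightarrow> nat \<Rightarrow>\<^sub>0 ('n, 'k) mpoly"]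
      indep that
    unfolding es(1) \<pi>_def by blast
  define a where "a i = (if i = 0 then map (\<lambda>k. exponent_degree (u k)) [0..<m]
    else if i = 1 then map (\<lambda>e. exponent_degree (pair_lcm u e)) es else [])" for i :: nat
  define \<phi> where "\<phi> i = (if i = 0 then \<pi> else (\<lambda>_. 0))" for i :: nat
  have free0: "free_submodule 0 = {0 :: nat \<Rightarrow>\<^sub>0 ('n, 'k) mpoly}"
    by (auto simp: free_submodule_def)
  have zero: "module_hom vscale vscale (\<lambda>_ :: nat \<Rightarrow>\<^sub>0 ('n, 'k) mpoly. 0 :: nat \<Rightarrow>\<^sub>0 ('n, 'k) mpoly)"
    by unfold_locales auto
  have image: "\<pi> ` free_submodule ?r = {v \<in> free_submodule m. augmentation u v = 0}"
    unfolding \<pi>_def free_module.image_extend_linearly_list es(1)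
    using E(2) by (simp add: syzygies_def)
  have "{v \<in> free_submodule ?r. \<pi> v = 0} = {0}"
    using ker module_hom.zero[OF \<pi>] by (auto simp: free_submodule_def)
  then have exact: "exact_resolution I (\<lambda>i. free_submodule (length (a i))) (augmentation u) \<phi>"
    unfolding exact_resolution_def
    using augmentation_hom \<pi> zero image image_augmentation[of u m]
    by (auto simp: a_def \<phi>_def I free0 image_constant_conv)
  have const: "lookup (lookup (?\<sigma> j) l) 0 = 0" if j: "j < ?r" for j l
  proof (cases "incidence (es ! j) l = (0 :: 'k)")
    case False
    obtain x y where xy: "es ! j = (x, y)" by force
    have l: "l = x \<or> l = y" using False xy by (auto simp: incidence_def split: if_splits)
    have "pair_lcm u (x, y) - u l \<noteq> 0"
    proof
      assume "pair_lcm u (x, y) - u l = 0"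
      then have "lookup (pair_lcm u (x, y)) i \<le> lookup (u l) i" for i
        by (metis diff_is_0_eq lookup_minus lookup_zero)
      then have "u x \<preceq> u l" "u y \<preceq> u l"
        by (auto simp: divides_exponent_def lookup_pair_lcm)
      then show False
        using antichain[of x l] antichain[of y l] edge[OF j] xy l by auto
    qed
    then show ?thesis using edge[OF j] xy by (simp add: lookup_pair_syzygy lookup_single when_def)
  qed (use edge[OF j] in \<open>simp add: lookup_pair_syzygy\<close>)
  have "lookup (lookup (\<pi> v) l) 0 = 0" if "v \<in> free_submodule ?r" for v l
  proof -
    have "order_at_least 1 (lookup v j * lookup (?\<sigma> j) l)" if "j < ?r" for j
      using order_at_least_mult[of 0 "lookup v j", OF _ const[OF that]]
      by (simp add: order_at_least_def)
    then have "order_at_least 1 (lookup (\<pi> v) l)"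
      unfolding \<pi>_def free_module.extend_linearly_free[OF that] lookup_sum lookup_vscale
      by (intro order_at_least_sum) auto
    then show ?thesis by (simp add: order_at_least_def)
  qed
  moreover have "homogeneous_vector (a 0) (exponent_degree (pair_lcm u (es ! j))) (?\<sigma> j)"
    if j: "j < ?r" for j
    unfolding homogeneous_vector_def
  proof (intro allI impI ballI)
    fix k w assume k: "k < length (a 0)" and w: "w \<in> keys (lookup (?\<sigma> j) k)"
    have "w = pair_lcm u (es ! j) - u k" "incidence (es ! j) k \<noteq> (0 :: 'k)"
      using w edge[OF j] by (auto simp: lookup_pair_syzygy split: if_splits)
    then have "w + u k = pair_lcm u (es ! j)"
      using incidence_divides divides_exponent_diff_add by metis
    then show "exponent_degree w + a 0 ! k = exponent_degree (pair_lcm u (es ! j))"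
      using k by (simp add: a_def flip: exponent_degree_add)
  qed
  moreover have "augmentation u (unit_vector k) = (monom (u k) :: ('n, 'k) mpoly)" for k
    by (simp add: unit_vector_def)
  ultimately have "minimal_graded_free_resolution I a (augmentation u) \<phi>"
    unfolding minimal_graded_free_resolution_def
    using exact free0
    by (auto simp: a_def \<phi>_def homogeneous_def monom_def \<pi>_def)
  then show ?thesis by blast
qed

section \<open>Consequences of a linear resolution\<close>

lemma lookup_mult_homogeneous:
  fixes p g :: "('n::finite, 'k::field) mpoly"
  assumes "homogeneous d g" "exponent_degree M = d"
  shows "lookup (p * g) M = lookup p 0 * lookup g M"
proof -
  define p' where "p' = p - single 0 (lookup p 0)"
  have "lookup (p' * g) M = 0"
  proof (rule ccontr)
    assume "lookup (p' * g) M \<noteq> 0"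
    then obtain a b where ab: "a \<in> keys p'" "b \<in> keys g" "M = a + b"
      using keys_multE[of M p' g] by (auto simp: in_keys_iff)
    then have "exponent_degree a = 0"
      using assms by (simp add: homogeneous_def exponent_degree_add)
    then show False using ab(1) by (simp add: p'_def in_keys_iff lookup_minus)
  qed
  moreover have "p * g = single 0 (lookup p 0) * g + p' * g"
    by (simp add: p'_def algebra_simps)
  ultimately show ?thesis by (simp add: lookup_add lookup_const_mult)
qed

lemma linear_resolution_generators:
  fixes I :: "('n::finite, 'k::field) mpoly set" and u :: "nat \<Rightarrow> 'n exponent"
  assumes res: "minimal_graded_free_resolution I a \<epsilon> \<phi>" and a0: "set (a 0) \<subseteq> {d}"
    and I: "I = ideal_generated (monom ` u ` {..<m})"
    and antichain: "\<And>k l. k < m \<Longrightarrow> l < m \<Longrightarrow> u k \<preceq> u l \<Longrightarrow> k = l"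
    and k: "k < m"
  shows "exponent_degree (u k) = d"
proof -
  let ?r = "length (a 0)"
  have \<epsilon>: "module_hom vscale (*) \<epsilon>" "\<epsilon> ` free_submodule ?r = I"
    and hom: "\<And>j. j < ?r \<Longrightarrow> homogeneous (a 0 ! j) (\<epsilon> (unit_vector j))"
    using res by (auto simp: minimal_graded_free_resolution_def exact_resolution_def)
  have "monom (u k) \<in> I" using k by (auto simp: I intro!: ring_module.span_base)
  then obtain v where v: "v \<in> free_submodule ?r" "monom (u k) = \<epsilon> v" using \<epsilon>(2) by blast
  \<comment> \<open>The monomial is a multiple of some monomial of one of the degree \<open>d\<close> generators, which in turn
    is a multiple of some \<open>u l\<close>; the antichain condition collapses this chain.\<close>
  have "u k \<in> keys (monom (u k) :: ('n, 'k) mpoly)" by (simp add: monom_def)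
  also have "monom (u k) = (\<Sum>j<?r. lookup v j * \<epsilon> (unit_vector j))"
    using v hom_eq_sum_free[OF \<epsilon>(1)] by simp
  finally obtain j where j: "j < ?r" "u k \<in> keys (lookup v j * \<epsilon> (unit_vector j))"
    by (rule keys_sumE) simp
  obtain w M where M: "M \<in> keys (\<epsilon> (unit_vector j))" "u k = w + M"
    using j(2) by (rule keys_multE)
  have "\<epsilon> (unit_vector j) \<in> I" using \<epsilon>(2) j(1) by auto
  then obtain l where l: "l < m" "u l \<preceq> M" using M(1) by (auto simp: I in_monomial_ideal_iff)
  then have "u l \<preceq> u k" using M(2) divides_exponent_trans divides_exponent_add(1) by metis
  then have "l = k" using antichain l(1) k by blast
  then have "M = u k" using l(2) M(2) by (metis divides_exponent_add(1) divides_exponent_antisym)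
  then show ?thesis using M(1) hom[OF j(1)] a0 nth_mem[OF j(1)] by (auto simp: homogeneous_def)
qed

text \<open>A resolution with generators in degree \<open>d\<close> and first syzygies in degree \<open>d + 1\<close> may use other
  generators than the monomials \<open>u k\<close>. Both families span the degree \<open>d\<close> part of \<open>I\<close> over the
  field, so matrices with constant entries lead from the monomials to the generators and back, and the
  composite is the identity because the monomials are linearly independent. They transport the linear
  entries of the relations of the resolution to syzygies of the monomials with linear entries, which are
  combinations of linear pair syzygies.\<close>
lemma linear_resolution_syzygies:
  fixes I :: "('n::finite, 'k::field) mpoly set" and u :: "nat \<Rightarrow> 'n exponent"
  assumes res: "minimal_graded_free_resolution I a \<epsilon> \<phi>"
    and a0: "set (a 0) \<subseteq> {d}" and a1: "set (a 1) \<subseteq> {Suc d}"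
    and I: "I = ideal_generated (monom ` u ` {..<m})"
    and antichain: "\<And>k l. k < m \<Longrightarrow> l < m \<Longrightarrow> u k \<preceq> u l \<Longrightarrow> k = l"
    and deg: "\<And>k. k < m \<Longrightarrow> exponent_degree (u k) = d"
  shows "free_module.span (pair_syzygy u `
      {e \<in> {(a, b). a < b \<and> b < m}. exponent_degree (pair_lcm u e) = Suc d})
    = (syzygies u m :: (nat \<Rightarrow>\<^sub>0 ('n, 'k) mpoly) set)"
    (is "free_module.span (pair_syzygy u ` ?D) = _")
proof (rule antisym)
  let ?N = "free_module.span (pair_syzygy u ` ?D) :: (nat \<Rightarrow>\<^sub>0 ('n, 'k) mpoly) set"
  show "?N \<subseteq> syzygies u m"
    by (rule free_module.span_minimal) (auto intro!: pair_syzygy_in_syzygies subspace_syzygies)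
  let ?r = "length (a 0)"
  define g where "g k = \<epsilon> (unit_vector k)" for k
  have \<epsilon>: "module_hom vscale (*) \<epsilon>" "\<epsilon> ` free_submodule ?r = I"
    and \<phi>: "module_hom vscale vscale (\<phi> 0)"
    and exact: "{v \<in> free_submodule ?r. \<epsilon> v = 0} = \<phi> 0 ` free_submodule (length (a 1))"
    and hom: "\<And>j. j < ?r \<Longrightarrow> homogeneous (a 0 ! j) (g j)"
    and hom1: "\<And>j. j < length (a 1) \<Longrightarrow> homogeneous_vector (a 0) (a 1 ! j) (\<phi> 0 (unit_vector j))"
    using res by (auto simp: minimal_graded_free_resolution_def exact_resolution_def g_def)
  have a0': "a 0 ! j = d" if "j < ?r" for j using a0 nth_mem[OF that] by auto
  have a1': "a 1 ! j = Suc d" if "j < length (a 1)" for j using a1 nth_mem[OF that] by auto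
  have g: "homogeneous d (g j)" "g j \<in> I" if "j < ?r" for j
    using hom[OF that] a0'[OF that] that \<epsilon>(2) by (auto simp: g_def)
  have g0: "lookup (g j) M = 0" if "j < ?r" "exponent_degree M \<noteq> d" for j M
    using g(1)[OF that(1)] that(2) by (auto simp: homogeneous_def in_keys_iff)
  interpret aug: module_hom vscale "(*)" "augmentation u :: _ \<Rightarrow> ('n, 'k) mpoly"
    by (rule augmentation_hom)
  interpret \<epsilon>: module_hom vscale "(*)" \<epsilon> by fact
  have "\<exists>v. v \<in> free_submodule ?r \<and> \<epsilon> v = monom (u b)" if b: "b < m" for b
  proof -
    have "monom (u b) \<in> I" using b by (auto simp: I intro!: ring_module.span_base)
    then show ?thesis using \<epsilon>(2) by (metis imageE)
  qed
  then obtain C where C: "\<And>b. b < m \<Longrightarrow> C b \<in> free_submodule ?r \<and> \<epsilon> (C b) = monom (u b)"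
    by metis
  \<comment> \<open>Only the constant terms of the coefficients matter: both families span the degree \<open>d\<close>
    part of \<open>I\<close> over the field.\<close>
  define c where "c b k = lookup (lookup (C b) k) 0" for b k
  have cg: "(\<Sum>k<?r. c b k * lookup (g k) M) = (if M = u b then 1 else 0)" if b: "b < m" for b M
  proof (cases "exponent_degree M = d")
    case True
    have "(\<Sum>k<?r. c b k * lookup (g k) M) = lookup (\<Sum>k<?r. lookup (C b) k * g k) M"
      by (simp add: lookup_sum lookup_mult_homogeneous[OF g(1) True] c_def)
    also have "(\<Sum>k<?r. lookup (C b) k * g k) = monom (u b)"
      using hom_eq_sum_free[OF \<epsilon>(1), of "C b" ?r] C[OF b] by (simp add: g_def)
    finally show ?thesis by (auto simp: lookup_monom)
  next
    case False
    then show ?thesis using deg[OF b] g0 by auto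
  qed
  \<comment> \<open>The two changes of basis with constant entries, from the monomials to the generators \<open>g\<close>
    of the resolution and back.\<close>
  define \<alpha> where "\<alpha> = extend_linearly vscale
    (\<lambda>b. \<Sum>k<?r. vscale (single 0 (c b k)) (unit_vector k :: nat \<Rightarrow>\<^sub>0 ('n, 'k) mpoly))"
  define \<beta> where "\<beta> = extend_linearly vscale
    (\<lambda>k. \<Sum>b<m. vscale (single 0 (lookup (g k) (u b))) (unit_vector b :: nat \<Rightarrow>\<^sub>0 ('n, 'k) mpoly))"
  have \<alpha>: "module_hom vscale vscale \<alpha>" and \<beta>: "module_hom vscale vscale \<beta>"
    unfolding \<alpha>_def \<beta>_def by (rule free_module.extend_linearly_hom)+
  interpret \<beta>: module_hom vscale vscale \<beta> by fact
  have \<alpha>_unit: "\<alpha> (unit_vector b) = (\<Sum>k<?r. vscale (single 0 (c b k)) (unit_vector k))" for b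
    by (simp add: \<alpha>_def)
  have \<beta>_unit: "\<beta> (unit_vector k) = (\<Sum>b<m. vscale (single 0 (lookup (g k) (u b))) (unit_vector b))" for k
    by (simp add: \<beta>_def)
  have \<alpha>_free: "\<alpha> v \<in> free_submodule ?r" for v
    unfolding \<alpha>_def extend_linearly_def
    by (intro free_module.subspace_sum free_module.subspace_scale subspace_free_submodule) auto
  have \<beta>_free: "\<beta> v \<in> free_submodule m" for v
    unfolding \<beta>_def extend_linearly_def
    by (intro free_module.subspace_sum free_module.subspace_scale subspace_free_submodule) auto
  have aug_unit: "augmentation u (unit_vector b) = (monom (u b) :: ('n, 'k) mpoly)" for b
    by (simp add: unit_vector_def)
  have \<epsilon>\<alpha>: "\<epsilon> (\<alpha> v) = augmentation u v" if v: "v \<in> free_submodule m" for v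
  proof -
    have "\<epsilon> (\<alpha> (unit_vector b)) = monom (u b)" if "b < m" for b
      by (rule poly_mapping_eqI)
         (auto simp: \<alpha>_unit \<epsilon>.sum \<epsilon>.scale lookup_sum lookup_const_mult cg[OF that] lookup_monom
           simp flip: g_def)
    then show ?thesis
      using hom_eq_sum_free[OF module_hom_compose[OF \<alpha> \<epsilon>(1)] v]
      by (simp add: augmentation_free[OF v])
  qed
  have aug\<beta>: "augmentation u (\<beta> v) = \<epsilon> v" if v: "v \<in> free_submodule ?r" for v
  proof -
    have "augmentation u (\<beta> (unit_vector k)) = \<epsilon> (unit_vector k)" if k: "k < ?r" for k
    proof (rule poly_mapping_eqI)
      fix M
      have inj: "u b = u b' \<longleftrightarrow> b = b'" if "b < m" "b' < m" for b b'
        using antichain that by (metis divides_exponent_refl)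
      have "lookup (augmentation u (\<beta> (unit_vector k))) M
          = (\<Sum>b<m. if u b = M then lookup (g k) M else 0)"
        unfolding \<beta>_unit aug.sum aug.scale aug_unit lookup_sum lookup_const_mult lookup_monom
        by (intro sum.cong) auto
      also have "\<dots> = lookup (g k) M"
      proof (cases "\<exists>b<m. u b = M")
        case True
        then obtain b where b: "b < m" "u b = M" by blast
        have "(\<Sum>b'<m. if u b' = M then lookup (g k) M else 0)
            = (\<Sum>b'<m. if b' = b then lookup (g k) M else 0)"
          using b inj by (intro sum.cong) auto
        then show ?thesis using b by simp
      next
        case False
        have "M \<notin> keys (g k)"
        proof
          assume M: "M \<in> keys (g k)"
          then obtain b where "b < m" "u b \<preceq> M"
            using g(2)[OF k] by (auto simp: I in_monomial_ideal_iff)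
          moreover have "exponent_degree M = d" using g(1)[OF k] M by (simp add: homogeneous_def)
          ultimately show False using False divides_exponent_same_degree deg by metis
        qed
        then show ?thesis using False by (auto simp: in_keys_iff)
      qed
      finally show "lookup (augmentation u (\<beta> (unit_vector k))) M = lookup (\<epsilon> (unit_vector k)) M"
        by (simp add: g_def)
    qed
    then show ?thesis
      using hom_eq_sum_free[OF module_hom_compose[OF \<beta> augmentation_hom] v]
        hom_eq_sum_free[OF \<epsilon>(1) v] by simp
  qed
  have \<beta>\<alpha>: "\<beta> (\<alpha> v) = v" if v: "v \<in> free_submodule m" for v
  proof -
    have "\<beta> (\<alpha> (unit_vector b)) = unit_vector b" if b: "b < m" for b
    proof (rule poly_mapping_eqI)
      fix l
      show "lookup (\<beta> (\<alpha> (unit_vector b))) l = lookup (unit_vector b) l"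
      proof (cases "l < m")
        case False
        then show ?thesis
          using \<beta>_free[of "\<alpha> (unit_vector b)"] b
          by (auto simp: free_submodule_def in_keys_iff lookup_unit_vector)
      next
        case True
        have "lookup (\<beta> (unit_vector k)) l = single 0 (lookup (g k) (u l))" for k
          unfolding \<beta>_unit using True
          by (simp add: lookup_sum lookup_unit_vector if_distrib cong: if_cong)
        then have "lookup (\<beta> (\<alpha> (unit_vector b))) l = (\<Sum>k<?r. single 0 (c b k * lookup (g k) (u l)))"
          by (simp add: \<alpha>_unit \<beta>.sum \<beta>.scale lookup_sum mult_single)
        also have "\<dots> = single 0 (\<Sum>k<?r. c b k * lookup (g k) (u l))"
          by (rule poly_mapping_eqI) (simp add: lookup_sum lookup_single when_def)
        also have "\<dots> = single 0 (if l = b then 1 else 0)"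
          unfolding cg[OF b] using antichain[of l b] True b by auto
        finally show ?thesis by (auto simp: lookup_unit_vector)
      qed
    qed
    then show ?thesis
      using hom_eq_sum_free[OF module_hom_compose[OF \<alpha> \<beta>] v]
        hom_eq_sum_free[OF free_module.module_hom_id v] by simp
  qed
  have linear: "\<beta> (\<phi> 0 (unit_vector l)) \<in> ?N" if l: "l < length (a 1)" for l
  proof (rule syzygy_in_binomial_span[where Q = "\<lambda>M. exponent_degree M = Suc d"])
    let ?v = "\<phi> 0 (unit_vector l)"
    have v: "?v \<in> free_submodule ?r" "\<epsilon> ?v = 0"
      using exact l unit_vector_free_submodule by blast+
    then show "\<beta> ?v \<in> syzygies u m"
      using \<beta>_free aug\<beta> by (simp add: syzygies_def)
    fix b w assume b: "b < m" and w: "w \<in> keys (lookup (\<beta> ?v) b)"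
    have "lookup (\<beta> ?v) b = (\<Sum>k<?r. lookup ?v k * single 0 (lookup (g k) (u b)))"
      unfolding \<beta>_def free_module.extend_linearly_free[OF v(1)] using b
      by (simp add: lookup_sum lookup_unit_vector if_distrib cong: if_cong)
    then obtain k where k: "k < ?r" "w \<in> keys (lookup ?v k * single 0 (lookup (g k) (u b)))"
      using w by (auto elim: keys_sumE)
    from k(2) obtain w' z where "w' \<in> keys (lookup ?v k)" "z \<in> keys (single 0 (lookup (g k) (u b)))"
      "w = w' + z" by (rule keys_multE)
    then have "w \<in> keys (lookup ?v k)" by (auto split: if_splits)
    then have "exponent_degree w + d = Suc d"
      using hom1[OF l] k(1) a0'[OF k(1)] a1'[OF l] by (auto simp: homogeneous_vector_def)
    then show "exponent_degree (w + u b) = Suc d"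
      by (simp add: exponent_degree_add deg[OF b])
  next
    fix k k' w w' assume k: "k < m" "k' < m" "k \<noteq> k'" and w: "w + u k = w' + u k'"
      and M: "exponent_degree (w + u k) = Suc d"
    have "u k \<preceq> w + u k" "u k' \<preceq> w + u k" by (simp, simp add: w)
    \<comment> \<open>The least common multiple divides a monomial of degree \<open>d + 1\<close> and is a proper multiple
      of a generator.\<close>
    have lin: "exponent_degree (pair_lcm u (x, y)) = Suc d"
      if xy: "x < m" "y < m" "x \<noteq> y" "u x \<preceq> w + u k" "u y \<preceq> w + u k" for x y
    proof -
      obtain t where t: "w + u k = t + pair_lcm u (x, y)"
        using pair_lcm_least[OF xy(4,5)] by (auto simp: divides_exponent_iff)
      obtain t' where t': "pair_lcm u (x, y) = t' + u x"
        using pair_lcm_upper(1)[of u "(x, y)"] by (auto simp: divides_exponent_iff)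
      have "t' \<noteq> 0"
      proof
        assume "t' = 0"
        then have "u y \<preceq> u x" using t' pair_lcm_upper(2)[of u "(x, y)"] by simp
        then show False using antichain xy by blast
      qed
      then have "exponent_degree t' > 0" by (simp flip: neq0_conv)
      then show ?thesis
        using arg_cong[OF t, of exponent_degree] arg_cong[OF t', of exponent_degree] M deg[OF xy(1)]
        unfolding exponent_degree_add by linarith
    qed
    then have "(k, k') \<in> ?D \<or> (k', k) \<in> ?D"
      using k \<open>u k \<preceq> w + u k\<close> \<open>u k' \<preceq> w + u k\<close> by (cases "k < k'") auto
    then show "single k (monom w) - single k' (monom w' :: ('n, 'k) mpoly) \<in> ?N"
      by (rule binomial_in_span_pairs[OF w])
  qed auto
  show "syzygies u m \<subseteq> ?N"
  proof
    fix f :: "nat \<Rightarrow>\<^sub>0 ('n, 'k) mpoly" assume "f \<in> syzygies u m"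
    then have f: "f \<in> free_submodule m" "augmentation u f = 0" by (simp_all add: syzygies_def)
    then have "\<alpha> f \<in> {v \<in> free_submodule ?r. \<epsilon> v = 0}" using \<alpha>_free \<epsilon>\<alpha> by simp
    then obtain h where h: "h \<in> free_submodule (length (a 1))" "\<alpha> f = \<phi> 0 h"
      unfolding exact by blast
    have "f = (\<Sum>l<length (a 1). vscale (lookup h l) (\<beta> (\<phi> 0 (unit_vector l))))"
      using \<beta>\<alpha>[OF f(1)] h(2) hom_eq_sum_free[OF module_hom_compose[OF \<phi> \<beta>] h(1)] by simp
    also have "\<dots> \<in> ?N"
      by (intro free_module.span_sum free_module.span_scale linear) simp
    finally show "f \<in> ?N" .
  qed
qed

section \<open>The tree of linear relations\<close>

text \<open>Independent pair syzygies form a forest: the columns of the incidence matrix are independent and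
  lie in the \<open>m - 1\<close>-dimensional space spanned by the differences of unit vectors.\<close>
lemma independent_pairs_card:
  fixes u :: "nat \<Rightarrow> 'n exponent"
  assumes E: "E \<subseteq> {(a, b). a < b \<and> b < m}" and m: "m > 0"
    and indep: "\<forall>h. (\<Sum>e\<in>E. vscale (h e) (pair_syzygy u e :: nat \<Rightarrow>\<^sub>0 ('n, 'k::field) mpoly)) = 0 \<longrightarrow>
      (\<forall>e\<in>E. h e = 0)"
  shows "card E < m"
proof -
  interpret V: vector_space "vscale :: 'k \<Rightarrow> (nat \<Rightarrow>\<^sub>0 'k) \<Rightarrow> _"
    by unfold_locales (simp_all add: free_module.scale_right_distrib free_module.scale_left_distrib)
  define \<delta> where "\<delta> e = single (fst e) 1 - (single (snd e) 1 :: nat \<Rightarrow>\<^sub>0 'k)" for e :: "nat \<times> nat"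
  have "E \<subseteq> {..<m} \<times> {..<m}" using E by auto
  then have fin: "finite E" by (rule finite_subset) simp
  have ne: "fst e \<noteq> snd e" if "e \<in> E" for e using that E by auto
  have look: "lookup (\<delta> e) k = incidence e k" if "e \<in> E" for e k
    using ne[OF that] by (auto simp: \<delta>_def lookup_minus lookup_single when_def incidence_def)
  \<comment> \<open>A relation between the vectors \<open>\<delta>\<close> is homogenized, in a multidegree \<open>M\<close> that all the
    least common multiples divide, to a relation between the pair syzygies.\<close>
  have zero: "c e = 0" if rel: "(\<Sum>e\<in>E. vscale (c e) (\<delta> e)) = 0" and e: "e \<in> E" for c e
  proof -
    define M where "M = (\<Sum>e\<in>E. pair_lcm u e)"
    have M: "pair_lcm u e \<preceq> M" if "e \<in> E" for e
      unfolding M_def sum.remove[OF fin that] by simp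
    have "(\<Sum>e\<in>E. c e * incidence e k) = lookup (\<Sum>e\<in>E. vscale (c e) (\<delta> e)) k" for k
      by (simp add: lookup_sum look)
    then have "(\<Sum>e\<in>E. c e * incidence e k) = 0" for k by (simp add: rel)
    then have "(\<Sum>e\<in>E. vscale (single (M - pair_lcm u e) (c e))
        (pair_syzygy u e :: nat \<Rightarrow>\<^sub>0 ('n, 'k) mpoly)) = 0"
      by (intro relation_from_coefficients ne M)
    then have "single (M - pair_lcm u e) (c e) = 0"
      using indep[rule_format, of "\<lambda>e. single (M - pair_lcm u e) (c e)" e] e by blast
    then show ?thesis by (metis lookup_single_eq lookup_zero)
  qed
  have inj: "inj_on \<delta> E"
  proof (rule inj_onI, rule ccontr)
    fix x y assume xy: "x \<in> E" "y \<in> E" "\<delta> x = \<delta> y" "x \<noteq> y"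
    define c :: "nat \<times> nat \<Rightarrow> 'k" where "c e = (if e = x then 1 else if e = y then -1 else 0)" for e
    have "(\<Sum>e\<in>E. vscale (c e) (\<delta> e)) = (\<Sum>e\<in>{x, y}. vscale (c e) (\<delta> e))"
      by (rule sum.mono_neutral_right) (use fin xy in \<open>auto simp: c_def\<close>)
    also have "\<dots> = 0" using xy(3,4) by (simp add: c_def)
    finally show False using zero[of c x] xy(1) by (simp add: c_def)
  qed
  have "\<not> free_module.dependent (\<delta> ` E)"
    unfolding free_module.dependent_finite[OF finite_imageI[OF fin]]
  proof safe
    fix w :: "(nat \<Rightarrow>\<^sub>0 'k) \<Rightarrow> 'k" and x y
    assume "(\<Sum>v\<in>\<delta> ` E. vscale (w v) v) = 0" "(x, y) \<in> E" "w (\<delta> (x, y)) \<noteq> 0"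
    then show False using zero[of "\<lambda>e. w (\<delta> e)"] by (simp add: sum.reindex[OF inj])
  qed
  moreover define T where "T = (\<lambda>k. single k 1 - (single 0 1 :: nat \<Rightarrow>\<^sub>0 'k)) ` {1..<m}"
  have T: "single k 1 - (single 0 1 :: nat \<Rightarrow>\<^sub>0 'k) \<in> free_module.span T" if "k < m" for k
  proof (cases "k = 0")
    case False
    then show ?thesis using that by (intro free_module.span_base) (auto simp: T_def)
  qed (simp add: free_module.span_zero)
  have "\<delta> e \<in> free_module.span T" if "e \<in> E" for e
  proof -
    have "\<delta> e = (single (fst e) 1 - single 0 1) - (single (snd e) 1 - single 0 1)"
      by (simp add: \<delta>_def)
    moreover have "fst e < m" "snd e < m" using E that by auto
    ultimately show ?thesis using free_module.span_diff[OF T T] by metis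
  qed
  then have "\<delta> ` E \<subseteq> free_module.span T" by auto
  moreover have "finite T" by (simp add: T_def)
  ultimately have "card (\<delta> ` E) \<le> card T" using V.independent_span_bound by blast
  also have "\<dots> \<le> m - 1" unfolding T_def using card_image_le[of "{1..<m}"] by fastforce
  finally show ?thesis using m by (simp add: card_image[OF inj])
qed

text \<open>The degrees of the vertices add up to \<open>2 |E| < 2 |V|\<close>.\<close>
lemma exists_leaf:
  fixes E :: "(nat \<times> nat) set"
  assumes "finite V" "finite E" "E \<subseteq> V \<times> V" "\<And>e. e \<in> E \<Longrightarrow> fst e \<noteq> snd e" "card E < card V"
  obtains k where "k \<in> V" "card {e \<in> E. k = fst e \<or> k = snd e} \<le> 1"
proof -
  have 1: "(\<Sum>k\<in>V. card {e \<in> E. k = f e}) = card E" if "f ` E \<subseteq> V" for f :: "nat \<times> nat \<Rightarrow> nat"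
  proof -
    have "card E = card (\<Union>k\<in>V. {e \<in> E. k = f e})"
      using that by (intro arg_cong[of _ _ card]) auto
    then show ?thesis by (subst (asm) card_UN_disjoint) (use assms in auto)
  qed
  have *: "card {e \<in> E. k = fst e \<or> k = snd e} = card {e \<in> E. k = fst e} + card {e \<in> E. k = snd e}" for k
    using assms(2,4) by (subst card_Un_disjoint[symmetric]) (auto intro!: arg_cong[of _ _ card])
  have "(\<Sum>k\<in>V. card {e \<in> E. k = fst e \<or> k = snd e}) = card E + card E"
  proof -
    have "fst ` E \<subseteq> V" "snd ` E \<subseteq> V" using assms(3) by auto
    then show ?thesis using 1[of fst] 1[of snd] * by (simp add: sum.distrib)
  qed
  also have "\<dots> < (\<Sum>k\<in>V. 2)" using assms(5) by simp
  finally have "\<exists>k\<in>V. card {e \<in> E. k = fst e \<or> k = snd e} < 2"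
    using sum_mono[of V "\<lambda>_. 2" "\<lambda>k. card {e \<in> E. k = fst e \<or> k = snd e}"] by (meson not_le)
  then show thesis using that by fastforce
qed

lemma exponent_degree_1E:
  assumes "exponent_degree (w :: 'n::finite exponent) = 1"
  obtains v where "w = single v 1"
proof -
  obtain v where v: "lookup w v \<noteq> 0"
    using assms by (metis exponent_degree_eq_0_iff poly_mapping_eqI lookup_zero zero_neq_one)
  then have "single v 1 \<preceq> w" by (auto simp: divides_exponent_def lookup_single when_def)
  moreover have "exponent_degree (single v 1 :: 'n exponent) = 1"
    by (simp add: exponent_degree_def lookup_single when_def)
  ultimately show thesis using that divides_exponent_same_degree assms by metis
qed

text \<open>The variable \<open>v\<close> generates the colon ideal of the predecessors of a generator by that
  generator. That it divides each predecessor exactly once makes its exponent in a product of predecessors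
  count the factors.\<close>
definition linear_elimination_order :: "'n exponent list \<Rightarrow> bool" where
  "linear_elimination_order us \<longleftrightarrow> (\<forall>i. 0 < i \<and> i < length us \<longrightarrow>
     (\<exists>v q. lookup (us ! i) v = 0 \<and> (\<forall>j<i. lookup (us ! j) v = 1) \<and>
        (\<exists>p<i. single v 1 + us ! i = single q 1 + us ! p)))"

text \<open>A leaf \<open>k\<close> is placed last. Since the syzygies of \<open>u k\<close> with the other generators are combinations
  of the edges, their \<open>k\<close>-th components are multiples of the one variable \<open>v\<close> that the edge at \<open>k\<close> has
  there. Removing the leaf and its edge leaves a generating set for the syzygies of the other generators.\<close>
lemma tree_elimination_order:
  fixes u :: "nat \<Rightarrow> 'n::finite exponent"
  assumes "finite V" "finite E" "E \<subseteq> V \<times> V" "\<And>e. e \<in> E \<Longrightarrow> fst e \<noteq> snd e" "card E < card V"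
    and deg: "\<And>k. k \<in> V \<Longrightarrow> exponent_degree (u k) = d"
    and lin: "\<And>e. e \<in> E \<Longrightarrow> exponent_degree (pair_lcm u e) = Suc d"
    and sqf: "\<And>k. k \<in> V \<Longrightarrow> squarefree_exponent (u k)"
    and gen: "\<forall>f :: nat \<Rightarrow> ('n, 'k::field) mpoly. (\<Sum>k\<in>V. f k * monom (u k)) = 0 \<longrightarrow>
      (\<exists>h. \<forall>k\<in>V. f k = (\<Sum>e\<in>E. h e * lookup (pair_syzygy u e) k))"
  shows "\<exists>xs. distinct xs \<and> set xs = V \<and> linear_elimination_order (map u xs)"
  using assms
proof (induction "card V" arbitrary: V E rule: less_induct)
  case less
  note fin = less.prems(1,2) and EV = less.prems(3) and ne = less.prems(4)
  obtain k where k: "k \<in> V" and leaf: "card {e \<in> E. k = fst e \<or> k = snd e} \<le> 1"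
    using exists_leaf[OF less.prems(1-5)] by blast
  let ?inc = "{e \<in> E. k = fst e \<or> k = snd e}"
  have no_inc: "lookup (pair_syzygy u e) k = (0 :: ('n, 'k) mpoly)" if "e \<in> E" "e \<notin> ?inc" for e
    using that ne[OF that(1)] by (auto simp: lookup_pair_syzygy incidence_def)
  show ?case
  proof (cases "V = {k}")
    case True
    then show ?thesis by (intro exI[of _ "[k]"]) (auto simp: linear_elimination_order_def)
  next
    case False
    then obtain k0 where k0: "k0 \<in> V" "k0 \<noteq> k" using k by blast
    \<comment> \<open>Comparing \<open>k\<close>-th components expresses a cofactor by the edges at \<open>k\<close>.\<close>
    have pair: "\<exists>h. monom (u l - u k) = (\<Sum>e\<in>E. h e * lookup (pair_syzygy u e) k :: ('n, 'k) mpoly)"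
      if l: "l \<in> V" "l \<noteq> k" for l
    proof -
      let ?f = "\<lambda>j. lookup (pair_syzygy u (k, l)) j :: ('n, 'k) mpoly"
      have "(\<Sum>j\<in>V. ?f j * monom (u j)) = (\<Sum>j\<in>{k, l}. ?f j * monom (u j))"
        by (rule sum.mono_neutral_right)
           (use fin k l in \<open>auto simp: lookup_pair_syzygy incidence_def split: if_splits\<close>)
      also have "\<dots> = augmentation u (pair_syzygy u (k, l))"
        unfolding augmentation_def
        by (subst ring_module.extend_linearly_superset[of "{k, l}"])
           (use l in \<open>auto simp: in_keys_iff lookup_pair_syzygy incidence_def split: if_splits\<close>)
      also have "\<dots> = 0"
      proof -
        have "pair_syzygy u (k, l) \<in> (syzygies u (Suc (max k l)) :: (nat \<Rightarrow>\<^sub>0 ('n, 'k) mpoly) set)"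
          by (rule pair_syzygy_in_syzygies) auto
        then show ?thesis by (simp add: syzygies_def)
      qed
      finally obtain h where "?f k = (\<Sum>e\<in>E. h e * lookup (pair_syzygy u e) k)"
        using less.prems(9) k by blast
      then show ?thesis using l by (auto simp: pair_syzygy_def lookup_minus lookup_single)
    qed
    \<comment> \<open>Without an edge at \<open>k\<close> these components would all vanish.\<close>
    have "?inc \<noteq> {}"
    proof
      assume "?inc = {}"
      then have none: "e \<notin> ?inc" for e by blast
      obtain h where "monom (u k0 - u k) = (\<Sum>e\<in>E. h e * lookup (pair_syzygy u e) k :: ('n, 'k) mpoly)"
        using pair[OF k0] by blast
      also have "\<dots> = 0" by (rule sum.neutral) (simp add: no_inc[OF _ none])
      finally show False by (metis lookup_monom lookup_zero zero_neq_one)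
    qed
    moreover have "finite ?inc" using fin(2) by simp
    ultimately have "card ?inc > 0" unfolding card_gt_0_iff by blast
    then have "card ?inc = 1" using leaf by linarith
    then obtain e where e: "?inc = {e}" by (auto simp: card_1_singleton_iff)
    then have eE: "e \<in> E" and ke: "k = fst e \<or> k = snd e" by auto
    define L where "L = pair_lcm u e"
    define l where "l = (if k = fst e then snd e else fst e)"
    have l: "l \<in> V" "l \<noteq> k" using ne[OF eE] ke EV eE by (auto simp: l_def)
    have kL: "u k \<preceq> L" and lL: "u l \<preceq> L"
      using ke pair_lcm_upper[of u e] by (auto simp: L_def l_def)
    have "exponent_degree (L - u k) = 1" "exponent_degree (L - u l) = 1"
      using exponent_degree_add[of "L - u k" "u k"] exponent_degree_add[of "L - u l" "u l"]
        kL lL less.prems(6) k l lin less.prems(7)[OF eE]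
      by (simp_all add: divides_exponent_diff_add L_def)
    then obtain v q where v: "L - u k = single v 1" and q: "L - u l = single q 1"
      by (metis exponent_degree_1E)
    have vq: "single v 1 + u k = single q 1 + u l"
      using divides_exponent_diff_add[OF kL] divides_exponent_diff_add[OF lL] v q by simp
    have single_term: "(\<Sum>e\<in>E. h e * lookup (pair_syzygy u e) k)
        = h e * single (single v 1) (incidence e k)" for h :: "_ \<Rightarrow> ('n, 'k) mpoly"
    proof -
      have "(\<Sum>e\<in>E. h e * lookup (pair_syzygy u e) k)
          = (\<Sum>e\<in>{e}. h e * lookup (pair_syzygy u e) k)"
        by (rule sum.mono_neutral_right) (use fin eE no_inc e in auto)
      then show ?thesis using ne[OF eE] v by (simp add: lookup_pair_syzygy L_def)
    qed
    have inc: "incidence e k \<noteq> (0 :: 'k)" using ke by (auto simp: incidence_def)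
    \<comment> \<open>Every \<open>k\<close>-th component is a multiple of the variable \<open>v\<close> of that edge.\<close>
    have v_occurs: "lookup (u k) v = 0 \<and> lookup (u j) v = 1" if j: "j \<in> V" "j \<noteq> k" for j
    proof -
      obtain h where "monom (u j - u k) = (h e * single (single v 1) (incidence e k) :: ('n, 'k) mpoly)"
        using pair[OF j] single_term by auto
      then have "lookup (h e * single (single v 1) (incidence e k) :: ('n, 'k) mpoly) (u j - u k) \<noteq> 0"
        by (metis lookup_monom zero_neq_one)
      then have "single v 1 \<preceq> u j - u k"
        by (auto simp: lookup_mult_single split: if_splits)
      then have "lookup (u j) v > lookup (u k) v"
        by (auto simp: divides_exponent_def lookup_minus dest!: spec[of _ v])
      moreover have "lookup (u j) v \<le> 1"
        using less.prems(8)[OF j(1)] by (simp add: squarefree_exponent_def)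
      ultimately show ?thesis by linarith
    qed
    \<comment> \<open>Syzygies that do not involve \<open>k\<close> do not use the edge at \<open>k\<close>.\<close>
    have gen': "\<exists>h. \<forall>j\<in>V - {k}. f j = (\<Sum>e\<in>E - {e}. h e * lookup (pair_syzygy u e) j)"
      if f: "(\<Sum>j\<in>V - {k}. f j * monom (u j)) = 0" for f :: "nat \<Rightarrow> ('n, 'k) mpoly"
    proof -
      define f' where "f' = f(k := 0)"
      have "(\<Sum>j\<in>V. f' j * monom (u j)) = (\<Sum>j\<in>V - {k}. f' j * monom (u j))"
        unfolding sum.remove[OF fin(1) k] by (simp add: f'_def)
      also have "\<dots> = (\<Sum>j\<in>V - {k}. f j * monom (u j))"
        by (intro sum.cong) (auto simp: f'_def)
      finally have "(\<Sum>j\<in>V. f' j * monom (u j)) = 0" using f by simp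
      then obtain h where h: "\<forall>j\<in>V. f' j = (\<Sum>e\<in>E. h e * lookup (pair_syzygy u e) j)"
        using less.prems(9) by blast
      have "h e * single (single v 1) (incidence e k) = 0"
        using bspec[OF h k] single_term[of h] by (simp add: f'_def)
      then have "lookup (h e * single (single v 1) (incidence e k)) (w + single v 1) = 0" for w
        by simp
      then have "h e = 0"
        using inc by (intro poly_mapping_eqI) (simp add: lookup_mult_single)
      then have "f j = (\<Sum>e\<in>E - {e}. h e * lookup (pair_syzygy u e) j)" if "j \<in> V - {k}" for j
        using bspec[OF h, of j] that unfolding sum.remove[OF fin(2) eE] by (simp add: f'_def)
      then show ?thesis by blast
    qed
    have "card (E - {e}) < card (V - {k})"
      using less.prems(5) card_Diff_singleton[OF eE] card_Diff_singleton[OF k]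
        card_gt_0_iff[of E] fin(2) eE by (metis diff_less_mono empty_iff Suc_leI One_nat_def)
    moreover have "E - {e} \<subseteq> (V - {k}) \<times> (V - {k})"
    proof
      fix x assume x: "x \<in> E - {e}"
      then have "x \<notin> ?inc" unfolding e by blast
      then show "x \<in> (V - {k}) \<times> (V - {k})" using x EV by (cases x) auto
    qed
    moreover have "card (V - {k}) < card V" using fin(1) k by (rule card_Diff1_less)
    ultimately obtain xs where xs: "distinct xs" "set xs = V - {k}" "linear_elimination_order (map u xs)"
      using less.hyps[of "V - {k}" "E - {e}"] less.prems(1,2,4,6-8) gen' by blast
    obtain p where p: "p < length xs" "xs ! p = l"
      using l xs(2) by (metis DiffI empty_iff in_set_conv_nth insert_iff)
    have "linear_elimination_order (map u (xs @ [k]))"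
      unfolding linear_elimination_order_def
    proof (intro allI impI)
      fix i assume i: "0 < i \<and> i < length (map u (xs @ [k]))"
      show "\<exists>v q. lookup (map u (xs @ [k]) ! i) v = 0 \<and> (\<forall>j<i. lookup (map u (xs @ [k]) ! j) v = 1) \<and>
          (\<exists>p<i. single v 1 + map u (xs @ [k]) ! i = single q 1 + map u (xs @ [k]) ! p)"
      proof (cases "i < length xs")
        case True
        then have *: "map u (xs @ [k]) ! j = map u xs ! j" if "j \<le> i" for j
          using that by (simp add: nth_append)
        obtain v q p where "lookup (map u xs ! i) v = 0" "\<forall>j<i. lookup (map u xs ! j) v = 1" "p < i"
          "single v 1 + map u xs ! i = single q 1 + map u xs ! p"
          using xs(3) i True unfolding linear_elimination_order_def by (metis length_map)
        then show ?thesis using * by (metis less_imp_le order_refl)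
      next
        case False
        then have i_eq: "i = length xs" using i by simp
        have "lookup (map u (xs @ [k]) ! j) v = 1" if "j < i" for j
          using that xs(2) nth_mem[of j xs] v_occurs by (auto simp: i_eq nth_append)
        moreover have "lookup (u k) v = 0" using v_occurs k0 by blast
        ultimately show ?thesis
          using vq p by (intro exI[of _ v] exI[of _ q] conjI exI[of _ p]) (auto simp: i_eq nth_append)
      qed
    qed
    moreover have "distinct (xs @ [k])" "set (xs @ [k]) = V" using xs k by auto
    ultimately show ?thesis by blast
  qed
qed

text \<open>The basis of pair syzygies is chosen twice: among all pairs in order to know that a minimal
  resolution exists, and then among the linear pairs that this resolution shows to be sufficient.\<close>
lemma exists_linear_elimination_order:
  fixes I :: "('n::finite, 'k::field) mpoly set"
  assumes sqf: "squarefree_monomial_ideal I" and pd: "projective_dimension I = 1"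
    and lin: "has_linear_resolution d I"
  obtains us where "I = ideal_generated (monom ` set us)"
    "\<And>x. x \<in> set us \<Longrightarrow> squarefree_exponent x" "\<And>x. x \<in> set us \<Longrightarrow> exponent_degree x = d"
    "linear_elimination_order us"
proof -
  obtain us where us: "distinct us" "\<And>x. x \<in> set us \<Longrightarrow> squarefree_exponent x"
    and I: "I = ideal_generated (monom ` set us)"
    and anti: "\<And>x y. x \<in> set us \<Longrightarrow> y \<in> set us \<Longrightarrow> x \<preceq> y \<Longrightarrow> x = y"
    using squarefree_minimal_generators[OF sqf] by blast
  let ?m = "length us" and ?u = "\<lambda>k. us ! k"
  have set: "set us = ?u ` {..<?m}" by (auto simp: set_conv_nth)
  have anti': "k = l" if "k < ?m" "l < ?m" "?u k \<preceq> ?u l" for k l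
    using anti[of "?u k" "?u l"] that us(1) by (simp add: nth_eq_iff_index_eq)
  have I': "I = ideal_generated (monom ` ?u ` {..<?m})" using I set by simp
  have pd': "has_projective_resolution I 1"
    using projective_dimension_attained[of I 1] pd by (simp add: one_enat_def)
  let ?a = "resolution_degrees I"
  have "\<exists>\<epsilon> \<phi>. minimal_graded_free_resolution I ?a \<epsilon> \<phi>"
    unfolding resolution_degrees_def
    using someI_ex[OF exists_minimal_graded_free_resolution[OF pd' I' anti']] by simp
  then obtain \<epsilon> \<phi> where res: "minimal_graded_free_resolution I ?a \<epsilon> \<phi>" by blast
  have a: "set (?a i) \<subseteq> {i + d}" for i
    using lin by (auto simp: has_linear_resolution_def graded_betti_def count_list_0_iff)
  have a0: "set (?a 0) \<subseteq> {d}" and a1: "set (?a 1) \<subseteq> {Suc d}" using a[of 0] a[of 1] by auto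
  have deg: "exponent_degree (?u k) = d" if "k < ?m" for k
    by (rule linear_resolution_generators[OF res a0 I' anti' that])
  let ?D = "{e \<in> {(a, b). a < b \<and> b < ?m}. exponent_degree (pair_lcm ?u e) = Suc d}"
  obtain E where E: "E \<subseteq> ?D"
    and gen: "free_module.span (pair_syzygy ?u ` E) = (syzygies ?u ?m :: (nat \<Rightarrow>\<^sub>0 ('n, 'k) mpoly) set)"
    and indep: "\<forall>h. (\<Sum>e\<in>E. vscale (h e) (pair_syzygy ?u e :: nat \<Rightarrow>\<^sub>0 ('n, 'k) mpoly)) = 0 \<longrightarrow>
      (\<forall>e\<in>E. h e = 0)"
    by (rule pair_syzygy_basis[OF pd' I' _ linear_resolution_syzygies[OF res a0 a1 I' anti' deg]]) blast
  have E': "E \<subseteq> {(a, b). a < b \<and> b < ?m}" using E by blast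
  have "E \<subseteq> {..<?m} \<times> {..<?m}" using E by auto
  then have fin: "finite E" by (rule finite_subset) simp
  have "\<exists>xs. distinct xs \<and> set xs = {..<?m} \<and> linear_elimination_order (map ?u xs)"
  proof (cases "?m = 0")
    case True
    then show ?thesis by (intro exI[of _ "[]"]) (auto simp: linear_elimination_order_def)
  next
    case False
    have "\<exists>h. \<forall>k\<in>{..<?m}. f k = (\<Sum>e\<in>E. h e * lookup (pair_syzygy ?u e) k)"
      if f: "(\<Sum>k\<in>{..<?m}. f k * monom (?u k)) = 0" for f :: "nat \<Rightarrow> ('n, 'k) mpoly"
    proof -
      define F where "F = (\<Sum>k<?m. single k (f k))"
      have look: "lookup F k = f k" if "k < ?m" for k
        using that by (simp add: F_def lookup_sum lookup_single when_def)
      have free: "F \<in> free_submodule ?m"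
        unfolding F_def
        by (intro free_module.subspace_sum[OF subspace_free_submodule] single_free_submodule) simp
      then have "F \<in> free_module.span (pair_syzygy ?u ` E)"
        unfolding gen syzygies_def using f by (simp add: augmentation_free look)
      then obtain h where "F = (\<Sum>e\<in>E. vscale (h e) (pair_syzygy ?u e))"
        using free_module.in_span_image_finite[OF fin] by blast
      then have "lookup F k = (\<Sum>e\<in>E. h e * lookup (pair_syzygy ?u e) k)" for k
        by (simp add: lookup_sum)
      then show ?thesis using look by (intro exI[of _ h]) auto
    qed
    moreover have "card E < card {..<?m}"
      using independent_pairs_card[OF E' _ indep] False by simp
    moreover have "E \<subseteq> {..<?m} \<times> {..<?m}" using E by auto
    moreover have "fst e \<noteq> snd e" "exponent_degree (pair_lcm ?u e) = Suc d" if "e \<in> E" for e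
      using that E by auto
    moreover have "squarefree_exponent (?u k)" if "k \<in> {..<?m}" for k
      using us(2) that by simp
    ultimately show ?thesis
      using fin deg by (intro tree_elimination_order[of _ E ?u d]) auto
  qed
  then obtain xs where xs: "set xs = {..<?m}" "linear_elimination_order (map ?u xs)" by blast
  then have same: "set (map ?u xs) = set us" by (simp add: set)
  have "exponent_degree x = d" if "x \<in> set us" for x
    using that deg by (auto simp: in_set_conv_nth)
  then show thesis using that[of "map ?u xs"] I us(2) xs(2) unfolding same by blast
qed

section \<open>Products of generators\<close>

definition product_exponent :: "'n exponent list \<Rightarrow> nat multiset \<Rightarrow> 'n exponent" where
  "product_exponent us X = (\<Sum>j\<in>#X. us ! j)"

lemma product_exponent_simps [simp]:
  "product_exponent us {#} = 0"
  "product_exponent us (add_mset j X) = us ! j + product_exponent us X"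
  "product_exponent us (X + Y) = product_exponent us X + product_exponent us Y"
  by (simp_all add: product_exponent_def)

lemma exponent_degree_product:
  assumes "\<And>x. x \<in> set us \<Longrightarrow> exponent_degree x = d" "set_mset X \<subseteq> {..<length us}"
  shows "exponent_degree (product_exponent us X) = size X * d"
  using assms(2) by (induction X) (simp_all add: exponent_degree_add assms(1))

lemma lookup_product_eq_size:
  assumes "\<And>j. j \<in># X \<Longrightarrow> lookup (us ! j) v = 1"
  shows "lookup (product_exponent us X) v = size X"
  using assms by (induction X) (simp_all add: lookup_add)

lemma lookup_product_le_size:
  assumes "\<And>j. j \<in># X \<Longrightarrow> lookup (us ! j) v \<le> 1"
  shows "lookup (product_exponent us X) v \<le> size X"
  using assms
proof (induction X)
  case (add j X)
  have "lookup (us ! j) v \<le> 1" "lookup (product_exponent us X) v \<le> size X"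
    using add by auto
  then show ?case by (simp add: lookup_add)
qed simp

text \<open>The variable of the largest index that is not common to \<open>X\<close> and \<open>Y\<close> divides every remaining factor
  on the side of \<open>X\<close> once, and misses at least one of the equally many remaining factors on the side of
  \<open>Y\<close>.\<close>
lemma product_separation:
  assumes sqf: "\<And>x. x \<in> set us \<Longrightarrow> squarefree_exponent x"
    and sep: "\<And>i. 0 < i \<Longrightarrow> i < length us \<Longrightarrow>
      lookup (us ! i) (v i) = 0 \<and> (\<forall>j<i. lookup (us ! j) (v i) = 1)"
    and Y: "set_mset Y \<subseteq> {..<length us}" and size: "size X = size Y" and less: "X < Y"
  obtains i where "i \<in># Y" "0 < i"
    "lookup (product_exponent us Y) (v i) < lookup (product_exponent us X) (v i)"
proof -
  \<comment> \<open>After the common factors are cancelled, the largest remaining index \<open>i\<close> lies in \<open>Y\<close>.\<close>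
  let ?X = "X - Y" and ?Y = "Y - X" and ?C = "X \<inter># Y"
  have X_eq: "X = ?C + ?X" and Y_eq: "Y = ?C + ?Y"
    by (rule multiset_eqI, simp)+
  have sizes: "size ?X = size ?Y"
    using size X_eq Y_eq by (metis add_left_cancel size_union)
  have "multp\<^sub>H\<^sub>O (<) X Y"
    using less by (simp add: less_multiset_def multp_eq_multp\<^sub>H\<^sub>O)
  then have dom: "\<And>x. x \<in># ?X \<Longrightarrow> \<exists>y\<in>#?Y. x < y"
    by (simp add: multp\<^sub>H\<^sub>O_iff_set_mset_less\<^sub>H\<^sub>O_set_mset)
  have "?Y \<noteq> {#}"
    using sizes X_eq Y_eq less by (metis add.right_neutral order_less_irrefl size_0 size_eq_0_iff_empty)
  define i where "i = Max (set_mset ?Y)"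
  have i: "i \<in># ?Y" unfolding i_def using \<open>?Y \<noteq> {#}\<close> by (intro Max_in) auto
  have below: "x < i" if "x \<in># ?X" for x
    using dom[OF that] by (auto simp: i_def intro: less_le_trans)
  have iY: "i \<in># Y" using i by (rule in_diffD)
  have "?X \<noteq> {#}" using sizes i by auto
  then have i0: "0 < i" using below by (metis gr0I less_zeroE multiset_nonemptyE)
  then have v: "lookup (us ! i) (v i) = 0" "\<And>j. j < i \<Longrightarrow> lookup (us ! j) (v i) = 1"
    using sep[of i] iY Y by auto
  have "lookup (product_exponent us ?X) (v i) = size ?X"
    by (rule lookup_product_eq_size) (use below v in auto)
  moreover have "lookup (product_exponent us ?Y) (v i) < size ?Y"
  proof -
    obtain Z where Z: "?Y = add_mset i Z" using i by (metis insert_DiffM)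
    have "lookup (us ! j) (v i) \<le> 1" if "j \<in># Z" for j
    proof -
      have "j \<in># Y" using that Z in_diffD[of j Y X] by simp
      then have "us ! j \<in> set us" using Y by auto
      then show ?thesis using sqf by (auto simp: squarefree_exponent_def)
    qed
    then have "lookup (product_exponent us Z) (v i) \<le> size Z" by (rule lookup_product_le_size)
    then show ?thesis by (simp add: Z lookup_add v)
  qed
  ultimately have "lookup (product_exponent us ?Y) (v i) < lookup (product_exponent us ?X) (v i)"
    using sizes by simp
  then have "lookup (product_exponent us Y) (v i) < lookup (product_exponent us X) (v i)"
    by (subst X_eq, subst Y_eq) (simp add: lookup_add)
  then show thesis using that iY i0 by blast
qed

lemma ideal_power_monomial:
  fixes us :: "'n exponent list"
  defines "I \<equiv> ideal_generated (monom ` set us) :: ('n, 'k::field) mpoly set"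
  shows "ideal_power I s = ideal_generated
    (monom ` product_exponent us ` multisets_of_size {..<length us} s)"
    (is "_ = ideal_generated (monom ` ?N ` ?W s)")
proof -
  have le: "\<exists>X\<in>?W s. ?N X \<preceq> M"
    if "\<forall>i<s. f i \<in> I" "M \<in> keys (\<Prod>i<s. f i)" for f :: "nat \<Rightarrow> ('n, 'k) mpoly" and s M
    using that
  proof (induction s arbitrary: M)
    case 0
    then show ?case by (auto simp: divides_exponent_def)
  next
    case (Suc s)
    from Suc.prems(2) have "M \<in> keys ((\<Prod>i<s. f i) * f s)" by simp
    then obtain a b where ab: "a \<in> keys (\<Prod>i<s. f i)" "b \<in> keys (f s)" "M = a + b"
      by (rule keys_multE)
    obtain X where X: "X \<in> ?W s" "?N X \<preceq> a" using Suc.IH[OF _ ab(1)] Suc.prems(1) by auto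
    have "f s \<in> I" using Suc.prems(1) by simp
    then obtain x where "x \<in> set us" "x \<preceq> b" using ab(2) by (auto simp: I_def in_monomial_ideal_iff)
    then obtain j where j: "j < length us" "us ! j \<preceq> b" by (auto simp: in_set_conv_nth)
    have "add_mset j X \<in> ?W (Suc s)" using X(1) j(1) by (auto simp: multisets_of_size_def)
    moreover have "?N (add_mset j X) \<preceq> M"
      using X(2) j(2) by (auto simp: ab(3) add.commute[of a b] divides_exponent_def lookup_add intro!: add_mono)
    ultimately show ?case by blast
  qed
  have ge: "\<exists>f. (\<forall>i<s. f i \<in> I) \<and> monom (?N X) = (\<Prod>i<s. f i)" if "X \<in> ?W s" for X s
    using that
  proof (induction s arbitrary: X)
    case 0
    then show ?case by (simp add: monom_def)
  next
    case (Suc s)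
    from Suc.prems have "size X = Suc s" "set_mset X \<subseteq> {..<length us}"
      by (auto simp: multisets_of_size_def)
    moreover then obtain j Y where "X = add_mset j Y" using size_eq_Suc_imp_eq_union by blast
    ultimately have X: "X = add_mset j Y" "j < length us" "Y \<in> ?W s"
      by (auto simp: multisets_of_size_def)
    obtain f where f: "\<forall>i<s. f i \<in> I" "monom (?N Y) = (\<Prod>i<s. f i)" using Suc.IH[OF X(3)] by blast
    have "monom (us ! j) \<in> I" using X(2) by (auto simp: I_def intro: ring_module.span_base)
    moreover have "(\<Prod>i<s. (f(s := monom (us ! j))) i) = (\<Prod>i<s. f i)"
      by (intro prod.cong) auto
    ultimately show ?case
      using f by (intro exI[of _ "f(s := monom (us ! j))"]) (auto simp: X(1) less_Suc_eq mult.commute simp flip: monom_mult)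
  qed
  show ?thesis
    unfolding ideal_power_def ring_module.span_eq
  proof (intro conjI subsetI)
    fix p assume "p \<in> {\<Prod>i<s. f i |f. \<forall>i<s. f i \<in> I}"
    then show "p \<in> ideal_generated (monom ` ?N ` ?W s)"
      using le by (auto simp: in_monomial_ideal_iff)
  next
    fix p assume "p \<in> (monom ` ?N ` ?W s :: ('n, 'k) mpoly set)"
    then have "p \<in> {\<Prod>i<s. f i |f. \<forall>i<s. f i \<in> I}" using ge by blast
    then show "p \<in> ideal_generated {\<Prod>i<s. f i |f. \<forall>i<s. f i \<in> I}"
      by (rule ring_module.span_base)
  qed
qed

section \<open>Linear quotients of powers\<close>

lemma set_take_sorted_list_of_set:
  fixes W :: "'a::linorder set"
  assumes "finite W" "i < card W"
  shows "set (take i (sorted_list_of_set W)) = {Z \<in> W. Z < sorted_list_of_set W ! i}"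
proof -
  let ?xs = "sorted_list_of_set W"
  have len: "length ?xs = card W" by simp
  have less: "?xs ! j < ?xs ! k" if "j < k" "k < card W" for j k
    using sorted_wrt_nth_less[OF strict_sorted_list_of_set that(1), of W] that(2) by simp
  show ?thesis
  proof (intro set_eqI iffI)
    fix Z assume "Z \<in> set (take i ?xs)"
    then obtain j where "j < i" "Z = ?xs ! j" using assms(2) by (auto simp: in_set_conv_nth)
    then show "Z \<in> {Z \<in> W. Z < ?xs ! i}"
      using less[of j i] assms nth_mem[of j ?xs] by auto
  next
    fix Z assume Z: "Z \<in> {Z \<in> W. Z < ?xs ! i}"
    then obtain j where j: "j < card W" "Z = ?xs ! j"
      using assms(1) by (metis (no_types, lifting) in_set_conv_nth len mem_Collect_eq set_sorted_list_of_set)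
    then have "j < i" using Z less[of i j] by (metis (no_types, lifting) mem_Collect_eq less_asym less_irrefl linorder_neqE_nat)
    then show "Z \<in> set (take i ?xs)" using j assms(2) by (auto simp: in_set_conv_nth)
  qed
qed

lemma powers_linear_quotients:
  fixes us :: "'n::finite exponent list"
  assumes sqf: "\<And>x. x \<in> set us \<Longrightarrow> squarefree_exponent x"
    and deg: "\<And>x. x \<in> set us \<Longrightarrow> exponent_degree x = d"
    and order: "linear_elimination_order us"
  shows "has_linear_quotients
    (ideal_power (ideal_generated (monom ` set us) :: ('n, 'k::field) mpoly set) s)"
proof -
  let ?m = "length us" and ?N = "product_exponent us"
  let ?W = "multisets_of_size {..<?m} s"
  let ?xs = "sorted_list_of_set ?W"
  have fin: "finite ?W" by (rule finite_multisets_of_size) simp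
  obtain v q p where vqp: "\<And>i. 0 < i \<Longrightarrow> i < ?m \<Longrightarrow>
      lookup (us ! i) (v i) = 0 \<and> (\<forall>j<i. lookup (us ! j) (v i) = 1) \<and> p i < i \<and>
      single (v i) 1 + us ! i = single (q i) 1 + us ! p i"
    using order unfolding linear_elimination_order_def by metis
  have separation: "\<exists>i. i \<in># Y \<and> 0 < i \<and> lookup (?N Y) (v i) < lookup (?N X) (v i)"
    if "X \<in> ?W" "Y \<in> ?W" "X < Y" for X Y
    by (rule product_separation[OF sqf, of us v Y X]) (use vqp that in \<open>auto simp: multisets_of_size_def\<close>)
  have inj: "inj_on ?N ?W"
  proof (rule inj_onI, rule ccontr)
    fix X Y assume "X \<in> ?W" "Y \<in> ?W" "?N X = ?N Y" "X \<noteq> Y"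
    then show False using separation[of X Y] separation[of Y X] by (metis linorder_neqE less_irrefl)
  qed
  define vs where "vs = map ?N ?xs"
  have set_vs: "set vs = ?N ` ?W" using fin by (simp add: vs_def)
  have "distinct vs" using inj fin by (simp add: vs_def distinct_map)
  moreover have "minimal_monomial_generators
      (ideal_power (ideal_generated (monom ` set us) :: ('n, 'k) mpoly set) s) (set vs)"
  proof (rule equidegree_minimal_generators)
    show "ideal_power (ideal_generated (monom ` set us)) s
        = (ideal_generated (monom ` set vs) :: ('n, 'k) mpoly set)"
      unfolding set_vs by (rule ideal_power_monomial)
    show "exponent_degree x = s * d" if "x \<in> set vs" for x
      using that exponent_degree_product[OF deg] by (auto simp: set_vs multisets_of_size_def)
  qed
  moreover have "\<exists>V. ideal_colon (ideal_generated (monom ` set (take i vs))) (monom (vs ! i))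
      = (ideal_generated (variable ` V) :: ('n, 'k) mpoly set)" if i: "i < length vs" for i
  proof -
    define Y where "Y = ?xs ! i"
    have i': "i < card ?W" using i by (simp add: vs_def)
    have Y: "Y \<in> ?W" using i fin nth_mem[of i ?xs] by (simp add: Y_def vs_def)
    have vs_i: "vs ! i = ?N Y" using i by (simp add: vs_def Y_def)
    have take: "set (take i vs) = ?N ` {Z \<in> ?W. Z < Y}"
      unfolding vs_def take_map Y_def set_take_sorted_list_of_set[OF fin i', symmetric] by simp
    define V where "V = v ` {k. k \<in># Y \<and> 0 < k}"
    have key: "(\<exists>a\<in>set (take i vs). a \<preceq> w + ?N Y) \<longleftrightarrow> (\<exists>x\<in>V. single x 1 \<preceq> w)" for w
    proof
      assume "\<exists>a\<in>set (take i vs). a \<preceq> w + ?N Y"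
      then obtain X where X: "X \<in> ?W" "X < Y" "?N X \<preceq> w + ?N Y" by (auto simp: take)
      obtain k where k: "k \<in># Y" "0 < k" "lookup (?N Y) (v k) < lookup (?N X) (v k)"
        using separation[OF X(1) Y X(2)] by blast
      have "lookup (?N X) (v k) \<le> lookup w (v k) + lookup (?N Y) (v k)"
        using X(3) by (simp add: divides_exponent_def lookup_add)
      then have "lookup w (v k) \<ge> 1" using k(3) by linarith
      then have "single (v k) 1 \<preceq> w" by (auto simp: divides_exponent_def lookup_single when_def)
      then show "\<exists>x\<in>V. single x 1 \<preceq> w" using k by (auto simp: V_def)
    next
      assume "\<exists>x\<in>V. single x 1 \<preceq> w"
      then obtain k where k: "k \<in># Y" "0 < k" "single (v k) 1 \<preceq> w" by (auto simp: V_def)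
      then have km: "k < ?m" using Y by (auto simp: multisets_of_size_def)
      obtain Z where Z: "Y = add_mset k Z" using k(1) by (metis insert_DiffM)
      \<comment> \<open>Replacing one factor \<open>k\<close> of \<open>Y\<close> by \<open>p k\<close> gives an earlier product.\<close>
      define X where "X = add_mset (p k) Z"
      note pk = vqp[OF k(2) km]
      have "X \<in> ?W" using Y pk km by (auto simp: X_def Z multisets_of_size_def)
      moreover have "X < Y" using pk by (simp add: X_def Z)
      moreover have "?N X \<preceq> w + ?N Y"
      proof -
        obtain w' where w': "w = w' + single (v k) 1" using k(3) by (auto simp: divides_exponent_iff)
        have "w + ?N Y = w' + (single (v k) 1 + us ! k) + ?N Z"
          by (simp add: w' Z add.assoc)
        also have "\<dots> = (w' + single (q k) 1) + ?N X"
          using pk by (simp add: X_def add.assoc)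
        finally show ?thesis by simp
      qed
      ultimately show "\<exists>a\<in>set (take i vs). a \<preceq> w + ?N Y" by (auto simp: take)
    qed
    have keys: "keys (f * monom (?N Y)) = (\<lambda>w. w + ?N Y) ` keys f" for f :: "('n, 'k) mpoly"
    proof (intro set_eqI iffI)
      fix M assume "M \<in> keys (f * monom (?N Y))"
      then have "?N Y \<preceq> M" "M - ?N Y \<in> keys f"
        by (auto simp: in_keys_iff lookup_mult_monom split: if_splits)
      then show "M \<in> (\<lambda>w. w + ?N Y) ` keys f"
        using divides_exponent_diff_add by (metis image_eqI)
    qed (auto simp: in_keys_iff lookup_mult_monom)
    have var: "variable ` V = (monom ` (\<lambda>x. single x 1) ` V :: ('n, 'k) mpoly set)"
      by (auto simp: variable_def image_image)
    have "ideal_colon (ideal_generated (monom ` set (take i vs))) (monom (vs ! i))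
        = (ideal_generated (variable ` V) :: ('n, 'k) mpoly set)"
      unfolding var ideal_colon_def vs_i
      by (intro set_eqI) (simp add: in_monomial_ideal_iff keys key)
    then show ?thesis by blast
  qed
  ultimately show ?thesis unfolding has_linear_quotients_def by blast
qed

theorem proposition3p4:
  fixes I :: "('n::finite, 'k::field) mpoly set" and d s :: nat
  assumes "squarefree_monomial_ideal I"
    and "projective_dimension I = 1"
    and "d \<ge> 1"
    and "has_linear_resolution d I"
    and "s \<ge> 1"
  shows "has_linear_quotients (ideal_power I s)"
proof -
  obtain us where "I = ideal_generated (monom ` set us)"
    "\<And>x. x \<in> set us \<Longrightarrow> squarefree_exponent x" "\<And>x. x \<in> set us \<Longrightarrow> exponent_degree x = d"
    "linear_elimination_order us"
    using exists_linear_elimination_order[OF assms(1,2,4)] by blast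
  then show ?thesis using powers_linear_quotients by blast
qed

end
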